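(* Let $T\ge2$, $\mathcal{T}=\{1,\dots,T\}$, and consider the general model described in the context. For each $i\in\mathcal{T}$ with $i\ge2$ there exists $\gamma_i\in(0,\infty)$ such that, as $\alpha\to\infty$, $$C^{\alpha}_{i,T-i+1}\bigg(\prod_{s=T-i+1}^{T-1}f_s-\prod_{s=T-i+1}^{T-1}\widehat{f}_s\bigg)^2\xrightarrow{d}\gamma_i^2\chi^2_1,$$ where $\chi^2_1$ has a chi-squared distribution with one degree of freedom. Moreover, if $Z$ and $D$ are independent, then $$\gamma_i^2=\lambda_i\operatorname{E}[ZI\{D\le T-i+1\}]\prod_{s=T-i+1}^{T-1}f_s^2\sum_{t=T-i+1}^{T-1}\frac{\sigma^2_t/f_t^2}{\sum_{j=1}^{T-t}\lambda_j\operatorname{E}[ZI\{D\le t\}]}.$$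
   Context: General model. Fix an integer $T\ge2$ and $\mathcal{T}=\{1,\dots,T\}$. For each $i\in\mathcal{T}$ there is a family of nonnegative integer-valued random variables $(M^{\alpha}_i)_{\alpha\ge0}$ and a sequence of random pairs $(D_{i,k},Z_{i,k})_{k\ge1}$ with $D_{i,k}\in\mathcal{T}$ and $Z_{i,k}$ real. Define $C^{\alpha}_{i,t}=\sum_{k=1}^{M^{\alpha}_i}Z_{i,k}I\{D_{i,k}\le t\}$ for $i,t\in\mathcal{T}$. Assumptions: (GM1) for each $i$, $(D_{i,k},Z_{i,k})_{k\ge1}$ is i.i.d. with a common distribution not depending on $i$; for a generic pair $(D,Z)$ with this distribution, $\operatorname{E}[Z^2]<\infty$ and $\operatorname{E}[ZI\{D=t\}]>0$ for all $t\in\mathcal{T}$. (GM2) For each $i$, $(D_{i,k},Z_{i,k})_{k\ge1}$ is independent of $(M^{\alpha}_i)_{\alpha\ge0}$. (GM3) The families $\{(M^{\alpha}_i)_\alpha,(D_{i,k},Z_{i,k})_{k\ge1}\}$, $i=1,\dots,T$, are independent. (GM4) For each $i$ there is $\lambda_i\in(0,\infty)$ with $M^{\alpha}_i/\alpha\to\lambda_i$ a.s. as $\alpha\to\infty$. Notation: for $t\le T-1$, $\widehat{f}_t=\sum_{i=1}^{T-t}C^{\alpha}_{i,t+1}/\sum_{i=1}^{T-t}C^{\alpha}_{i,t}$ and $f_t=\operatorname{E}[ZI\{D\le t+1\}]/\operatorname{E}[ZI\{D\le t\}]$; and $$\sigma^2_t=(f_t-1)\bigg(\frac{\operatorname{E}[Z^2I\{D=t+1\}]}{\operatorname{E}[ZI\{D=t+1\}]}+(f_t-1)\frac{\operatorname{E}[Z^2I\{D\le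 t\}]}{\operatorname{E}[ZI\{D\le t\}]}\bigg).$$ *)

theory Defs
  imports "HOL-Probability.Probability"
begin

definition Cl :: "(nat \<Rightarrow> real \<Rightarrow> 'a \<Rightarrow> nat) \<Rightarrow> (nat \<Rightarrow> nat \<Rightarrow> 'a \<Rightarrow> nat) \<Rightarrow> (nat \<Rightarrow> nat \<Rightarrow> 'a \<Rightarrow> real)
    \<Rightarrow> real \<Rightarrow> nat \<Rightarrow> nat \<Rightarrow> 'a \<Rightarrow> real" where
  "Cl Mc D Z \<alpha> i t \<omega> = (\<Sum>k = 1..Mc i \<alpha> \<omega>. Z i k \<omega> * (if D i k \<omega> \<le> t then 1 else 0))"

definition fhat :: "nat \<Rightarrow> (nat \<Rightarrow> real \<Rightarrow> 'a \<Rightarrow> nat) \<Rightarrow> (nat \<Rightarrow> nat \<Rightarrow> 'a \<Rightarrow> nat) \<Rightarrow> (nat \<Rightarrow> nat \<Rightarrow> 'a \<Rightarrow> real)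
    \<Rightarrow> real \<Rightarrow> nat \<Rightarrow> 'a \<Rightarrow> real" where
  "fhat T Mc D Z \<alpha> t \<omega> =
     (\<Sum>i = 1..T - t. Cl Mc D Z \<alpha> i (t + 1) \<omega>) / (\<Sum>i = 1..T - t. Cl Mc D Z \<alpha> i t \<omega>)"

definition EZle :: "'a measure \<Rightarrow> ('a \<Rightarrow> nat) \<Rightarrow> ('a \<Rightarrow> real) \<Rightarrow> nat \<Rightarrow> real" where
  "EZle M D Z t = (\<integral>\<omega>. Z \<omega> * (if D \<omega> \<le> t then 1 else 0) \<partial>M)"
definition EZeq :: "'a measure \<Rightarrow> ('a \<Rightarrow> nat) \<Rightarrow> ('a \<Rightarrow> real) \<Rightarrow> nat \<Rightarrow> real" where
  "EZeq M D Z t = (\<integral>\<omega>. Z \<omega> * (if D \<omega> = t then 1 else 0) \<partial>M)"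
definition EZ2le :: "'a measure \<Rightarrow> ('a \<Rightarrow> nat) \<Rightarrow> ('a \<Rightarrow> real) \<Rightarrow> nat \<Rightarrow> real" where
  "EZ2le M D Z t = (\<integral>\<omega>. (Z \<omega>)\<^sup>2 * (if D \<omega> \<le> t then 1 else 0) \<partial>M)"
definition EZ2eq :: "'a measure \<Rightarrow> ('a \<Rightarrow> nat) \<Rightarrow> ('a \<Rightarrow> real) \<Rightarrow> nat \<Rightarrow> real" where
  "EZ2eq M D Z t = (\<integral>\<omega>. (Z \<omega>)\<^sup>2 * (if D \<omega> = t then 1 else 0) \<partial>M)"

definition fdev :: "'a measure \<Rightarrow> ('a \<Rightarrow> nat) \<Rightarrow> ('a \<Rightarrow> real) \<Rightarrow> nat \<Rightarrow> real" where
  "fdev M D Z t = EZle M D Z (t + 1) / EZle M D Z t"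

definition sigma2 :: "'a measure \<Rightarrow> ('a \<Rightarrow> nat) \<Rightarrow> ('a \<Rightarrow> real) \<Rightarrow> nat \<Rightarrow> real" where
  "sigma2 M D Z t = (fdev M D Z t - 1) *
     (EZ2eq M D Z (t + 1) / EZeq M D Z (t + 1) + (fdev M D Z t - 1) * (EZ2le M D Z t / EZle M D Z t))"

definition chi_sq1 :: "real measure" where
  "chi_sq1 = distr (density lborel std_normal_density) borel (\<lambda>x. x\<^sup>2)"

definition conv_distr_at_top :: "'a measure \<Rightarrow> (real \<Rightarrow> 'a \<Rightarrow> real) \<Rightarrow> real measure \<Rightarrow> bool" where
  "conv_distr_at_top M X L \<longleftrightarrow>
     (\<forall>\<^sub>F \<alpha> in at_top. X \<alpha> \<in> borel_measurable M) \<and>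
     (\<forall>x. isCont (cdf L) x \<longrightarrow> ((\<lambda>\<alpha>. cdf (distr M borel (X \<alpha>)) x) \<longlongrightarrow> cdf L x) at_top)"

end

theory Submission
  imports Defs
begin

text \<open>Along any sequence \<open>\<alpha>\<^sub>n\<close> tending to infinity, \<open>\<surd>\<alpha>\<^sub>n\<close> times the error of the estimated development factor
  of index \<open>t\<close> is, up to a term vanishing in probability, a sum over the years \<open>j \<le> T - t\<close> of the centred
  claims \<open>Z (I{D = t + 1} - (f\<^sub>t - 1) I{D \<le> t})\<close>, divided by \<open>\<surd>\<alpha>\<^sub>n\<close> and by a constant. The same holds for
  products of such factors, so the error of the product is asymptotically a sum of independent random sums, one
  per year. As the number of claims is independent of the claims, each of these has characteristic function
  \<open>E[\<phi>(u/\<surd>\<alpha>\<^sub>n)\<^sup>M]\<close>, which converges to that of a normal law by dominated convergence; the variances add up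
  to a positive number because the last year contributes a nondegenerate residual. Squaring, and replacing
  \<open>C/\<alpha>\<^sub>n\<close> by its limit in probability, gives the chi-squared law. If \<open>Z\<close> and \<open>D\<close> are independent, the
  residuals of different indices \<open>t\<close> are orthogonal and the variance has the stated form.\<close>

section \<open>Convergence in probability and tightness\<close>

text \<open>The numbers of claims carry no moment assumption, only an almost sure growth rate, so
  variances of the random sums need not exist. Chebyshev's inequality is therefore applied for a
  fixed number of claims, and the number is cut off at a multiple of \<alpha>; this yields
  tightness, and the weak laws are read off from the tightness of centred sums. In the same way
  \<open>Z\<close> has only two moments at hand, so the characteristic function of one claim is
  compared with a normal exponential up to an error of smaller order than \<open>1 / a n\<close>,
  which is just small enough to survive a power of order \<open>a n\<close>. Estimated factors of
  different indices are built from overlapping accident years and are dependent. The linear term is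
  a double sum over indices and years; summing over the indices inside each year is what restores
  independence. In the coefficients, \<open>Lam s * e s\<close> is the limit of the denominator of
  the factor of index \<open>s\<close> divided by \<alpha>, and dividing the full product by
  \<open>f s\<close> comes from the product rule.\<close>

definition (in prob_space) conv_prob :: "(nat \<Rightarrow> 'a \<Rightarrow> real) \<Rightarrow> real \<Rightarrow> bool" where
  "conv_prob X c \<longleftrightarrow> (\<forall>n. X n \<in> borel_measurable M) \<and>
     (\<forall>e>0. (\<lambda>n. prob {\<omega> \<in> space M. e < \<bar>X n \<omega> - c\<bar>}) \<longlonglongrightarrow> 0)"

text \<open>The tail bound is demanded only for large \<open>n\<close>, so no finite set of indices
  ever has to be controlled.\<close>

definition (in prob_space) tight_seq :: "(nat \<Rightarrow> 'a \<Rightarrow> real) \<Rightarrow> bool" where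
  "tight_seq X \<longleftrightarrow> (\<forall>n. X n \<in> borel_measurable M) \<and>
     (\<forall>d>0. \<exists>K. \<forall>\<^sub>F n in sequentially. prob {\<omega> \<in> space M. K < \<bar>X n \<omega>\<bar>} \<le> d)"

context prob_space
begin

lemma conv_prob_measurable: "conv_prob X c \<Longrightarrow> X n \<in> borel_measurable M"
  by (simp add: conv_prob_def)

lemma tight_seq_measurable: "tight_seq X \<Longrightarrow> X n \<in> borel_measurable M"
  by (simp add: tight_seq_def)

lemma conv_probD: "conv_prob X c \<Longrightarrow> 0 < e \<Longrightarrow> (\<lambda>n. prob {\<omega> \<in> space M. e < \<bar>X n \<omega> - c\<bar>}) \<longlonglongrightarrow> 0"
  by (simp add: conv_prob_def)

lemma prob_le_add:
  assumes "\<And>\<omega>. \<omega> \<in> space M \<Longrightarrow> P \<omega> \<Longrightarrow> Q \<omega> \<or> R \<omega>"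
    and "{\<omega> \<in> space M. Q \<omega>} \<in> events" "{\<omega> \<in> space M. R \<omega>} \<in> events"
  shows "prob {\<omega> \<in> space M. P \<omega>} \<le> prob {\<omega> \<in> space M. Q \<omega>} + prob {\<omega> \<in> space M. R \<omega>}"
proof -
  have "prob {\<omega> \<in> space M. P \<omega>} \<le> prob ({\<omega> \<in> space M. Q \<omega>} \<union> {\<omega> \<in> space M. R \<omega>})"
    using assms by (intro finite_measure_mono) auto
  also have "\<dots> \<le> prob {\<omega> \<in> space M. Q \<omega>} + prob {\<omega> \<in> space M. R \<omega>}"
    by (intro measure_Un_le assms)
  finally show ?thesis .
qed

text \<open>Serves to ignore an event of vanishing probability, such as a denominator being
  zero.\<close>

lemma conv_prob_cong:
  assumes X: "conv_prob X c" and Y: "\<And>n. Y n \<in> borel_measurable M"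
    and ne: "(\<lambda>n. prob {\<omega> \<in> space M. X n \<omega> \<noteq> Y n \<omega>}) \<longlonglongrightarrow> 0"
  shows "conv_prob Y c"
  unfolding conv_prob_def
proof (intro conjI allI impI Y)
  fix e :: real assume "e > 0"
  note [measurable] = conv_prob_measurable[OF X] Y
  have lim: "(\<lambda>n. prob {\<omega> \<in> space M. e < \<bar>X n \<omega> - c\<bar>} + prob {\<omega> \<in> space M. X n \<omega> \<noteq> Y n \<omega>}) \<longlonglongrightarrow> 0"
    using tendsto_add[OF conv_probD[OF X \<open>e > 0\<close>] ne] by simp
  have "prob {\<omega> \<in> space M. e < \<bar>Y n \<omega> - c\<bar>} \<le>
      prob {\<omega> \<in> space M. e < \<bar>X n \<omega> - c\<bar>} + prob {\<omega> \<in> space M. X n \<omega> \<noteq> Y n \<omega>}" for n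
    by (rule prob_le_add) auto
  then show "(\<lambda>n. prob {\<omega> \<in> space M. e < \<bar>Y n \<omega> - c\<bar>}) \<longlonglongrightarrow> 0"
    by (intro tendsto_sandwich[OF _ _ tendsto_const lim]) auto
qed

lemma conv_prob_const: "conv_prob (\<lambda>n \<omega>. c) c"
  by (simp add: conv_prob_def)

text \<open>Dominated convergence, applied to the indicators of the deviation events: along almost
  every path they are eventually zero.\<close>

lemma conv_prob_AE:
  assumes X: "\<And>n. X n \<in> borel_measurable M" and lim: "AE \<omega> in M. (\<lambda>n. X n \<omega>) \<longlonglongrightarrow> c"
  shows "conv_prob X c"
  unfolding conv_prob_def
proof (intro conjI allI impI X)
  note [measurable] = X
  fix e :: real assume "e > 0"
  let ?B = "\<lambda>n. {\<omega> \<in> space M. e < \<bar>X n \<omega> - c\<bar>}"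
  have "(\<lambda>n. \<integral>\<omega>. indicator (?B n) \<omega> \<partial>M) \<longlonglongrightarrow> (\<integral>\<omega>. 0 \<partial>M :: real)"
  proof (rule integral_dominated_convergence[where w = "\<lambda>_. 1"])
    show "AE \<omega> in M. (\<lambda>n. indicator (?B n) \<omega> :: real) \<longlonglongrightarrow> 0"
      using lim
    proof eventually_elim
      fix \<omega> assume "(\<lambda>n. X n \<omega>) \<longlonglongrightarrow> c"
      then have "\<forall>\<^sub>F n in sequentially. dist (X n \<omega>) c < e"
        using \<open>e > 0\<close> by (rule tendstoD)
      then have "\<forall>\<^sub>F n in sequentially. indicator (?B n) \<omega> = (0 :: real)"
        by eventually_elim (auto simp: dist_real_def)
      then show "(\<lambda>n. indicator (?B n) \<omega> :: real) \<longlonglongrightarrow> 0"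
        by (rule tendsto_eventually)
    qed
  qed (auto simp: indicator_def)
  then show "(\<lambda>n. prob (?B n)) \<longlonglongrightarrow> 0"
    by (simp add: inf.absorb1 Collect_restrict)
qed

lemma conv_prob_seq: "x \<longlonglongrightarrow> c \<Longrightarrow> conv_prob (\<lambda>n \<omega>. x n) c"
  by (rule conv_prob_AE) auto

text \<open>Continuity is asked for at the limit point alone, which is what admits division by a
  sequence with nonzero limit. As \<open>g\<close> is arbitrary elsewhere, measurability of the
  composition is a separate assumption.\<close>

lemma conv_prob_comp2:
  assumes X: "conv_prob X a" and Y: "conv_prob Y b"
    and g: "isCont (\<lambda>p. g (fst p) (snd p)) (a, b)"
    and meas: "\<And>n. (\<lambda>\<omega>. g (X n \<omega>) (Y n \<omega>)) \<in> borel_measurable M"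
  shows "conv_prob (\<lambda>n \<omega>. g (X n \<omega>) (Y n \<omega>)) (g a b)"
  unfolding conv_prob_def
proof (intro conjI allI impI meas)
  fix e :: real assume "e > 0"
  note [measurable] = conv_prob_measurable[OF X] conv_prob_measurable[OF Y] meas
  obtain d where "d > 0" and d: "\<And>p. dist p (a, b) < d \<Longrightarrow> dist (g (fst p) (snd p)) (g a b) < e"
    using g[unfolded continuous_at_eps_delta] \<open>e > 0\<close> by (auto simp: dist_commute)
  \<comment> \<open>With a third of \<open>d\<close> for each coordinate, the two errors together
    stay strictly below \<open>d\<close>.\<close>
  define d' where "d' = d / 3"
  have d': "d' > 0" using \<open>d > 0\<close> by (simp add: d'_def)
  have close: "\<bar>g x y - g a b\<bar> \<le> e" if "\<bar>x - a\<bar> \<le> d'" "\<bar>y - b\<bar> \<le> d'" for x y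
  proof -
    have "dist (x, y) (a, b) \<le> dist x a + dist y b"
      by (simp add: dist_Pair_Pair sqrt_sum_squares_le_sum)
    also have "\<dots> < d" using that \<open>d > 0\<close> by (simp add: d'_def dist_real_def)
    finally show ?thesis using d[of "(x, y)"] by (simp add: dist_real_def)
  qed
  have lim: "(\<lambda>n. prob {\<omega> \<in> space M. d' < \<bar>X n \<omega> - a\<bar>} + prob {\<omega> \<in> space M. d' < \<bar>Y n \<omega> - b\<bar>}) \<longlonglongrightarrow> 0"
    using tendsto_add[OF conv_probD[OF X d'] conv_probD[OF Y d']] by simp
  have "prob {\<omega> \<in> space M. e < \<bar>g (X n \<omega>) (Y n \<omega>) - g a b\<bar>} \<le>
      prob {\<omega> \<in> space M. d' < \<bar>X n \<omega> - a\<bar>} + prob {\<omega> \<in> space M. d' < \<bar>Y n \<omega> - b\<bar>}" for n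
    by (rule prob_le_add) (use close in \<open>auto simp: not_less [symmetric]\<close>)
  then show "(\<lambda>n. prob {\<omega> \<in> space M. e < \<bar>g (X n \<omega>) (Y n \<omega>) - g a b\<bar>}) \<longlonglongrightarrow> 0"
    by (intro tendsto_sandwich[OF _ _ tendsto_const lim]) auto
qed

lemma conv_prob_add: "conv_prob X a \<Longrightarrow> conv_prob Y b \<Longrightarrow> conv_prob (\<lambda>n \<omega>. X n \<omega> + Y n \<omega>) (a + b)"
  by (rule conv_prob_comp2[where g = "(+)"])
     (auto intro!: continuous_intros borel_measurable_add simp: conv_prob_measurable)

lemma conv_prob_diff: "conv_prob X a \<Longrightarrow> conv_prob Y b \<Longrightarrow> conv_prob (\<lambda>n \<omega>. X n \<omega> - Y n \<omega>) (a - b)"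
  by (rule conv_prob_comp2[where g = "(-)"])
     (auto intro!: continuous_intros borel_measurable_diff simp: conv_prob_measurable)

lemma conv_prob_mult: "conv_prob X a \<Longrightarrow> conv_prob Y b \<Longrightarrow> conv_prob (\<lambda>n \<omega>. X n \<omega> * Y n \<omega>) (a * b)"
  by (rule conv_prob_comp2[where g = "(*)"])
     (auto intro!: continuous_intros borel_measurable_times simp: conv_prob_measurable)

lemma conv_prob_divide:
  "conv_prob X a \<Longrightarrow> conv_prob Y b \<Longrightarrow> b \<noteq> 0 \<Longrightarrow> conv_prob (\<lambda>n \<omega>. X n \<omega> / Y n \<omega>) (a / b)"
  by (rule conv_prob_comp2[where g = "(/)"])
     (auto intro!: continuous_intros borel_measurable_divide simp: conv_prob_measurable)

lemma conv_prob_sum: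
  "(\<And>s. s \<in> A \<Longrightarrow> conv_prob (X s) (a s)) \<Longrightarrow> conv_prob (\<lambda>n \<omega>. \<Sum>s\<in>A. X s n \<omega>) (\<Sum>s\<in>A. a s)"
  by (induction A rule: infinite_finite_induct) (auto intro: conv_prob_const conv_prob_add)

text \<open>The definition allows any real \<open>K\<close>; a positive one is needed as soon as one
  divides by it.\<close>

lemma tight_seqD:
  assumes "tight_seq X" "d > 0"
  obtains K where "K > 0" "\<forall>\<^sub>F n in sequentially. prob {\<omega> \<in> space M. K < \<bar>X n \<omega>\<bar>} \<le> d"
proof -
  obtain K where K: "\<forall>\<^sub>F n in sequentially. prob {\<omega> \<in> space M. K < \<bar>X n \<omega>\<bar>} \<le> d"
    using assms by (auto simp: tight_seq_def)
  note [measurable] = tight_seq_measurable[OF assms(1)]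
  have "prob {\<omega> \<in> space M. max K 1 < \<bar>X n \<omega>\<bar>} \<le> prob {\<omega> \<in> space M. K < \<bar>X n \<omega>\<bar>}" for n
    by (intro finite_measure_mono) auto
  then have "\<forall>\<^sub>F n in sequentially. prob {\<omega> \<in> space M. max K 1 < \<bar>X n \<omega>\<bar>} \<le> d"
    using K by (auto elim!: eventually_mono intro: order_trans)
  then show ?thesis by (intro that[of "max K 1"]) auto
qed

lemma tight_seq_conv_prob:
  assumes X: "conv_prob X c"
  shows "tight_seq X"
  unfolding tight_seq_def
proof (intro conjI allI impI)
  note [measurable] = conv_prob_measurable[OF X]
  show "X n \<in> borel_measurable M" for n by simp
  fix d :: real assume "d > 0"
  have "\<forall>\<^sub>F n in sequentially. prob {\<omega> \<in> space M. 1 < \<bar>X n \<omega> - c\<bar>} < d"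
    using conv_probD[OF X, of 1] \<open>d > 0\<close> by (auto intro: order_tendstoD)
  moreover have "prob {\<omega> \<in> space M. \<bar>c\<bar> + 1 < \<bar>X n \<omega>\<bar>} \<le> prob {\<omega> \<in> space M. 1 < \<bar>X n \<omega> - c\<bar>}" for n
    by (intro finite_measure_mono) auto
  ultimately show "\<exists>K. \<forall>\<^sub>F n in sequentially. prob {\<omega> \<in> space M. K < \<bar>X n \<omega>\<bar>} \<le> d"
    by (intro exI[of _ "\<bar>c\<bar> + 1"]) (auto elim!: eventually_mono intro: order_trans less_imp_le)
qed

text \<open>Boundedness of \<open>g\<close> on boxes is all that matters: outside the two tail
  events, each given half of \<open>d\<close>, the value is at most \<open>b K L\<close>. This
  covers sums and products alike.\<close>

lemma tight_seq_comp2: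
  assumes X: "tight_seq X" and Y: "tight_seq Y"
    and meas: "\<And>n. (\<lambda>\<omega>. g (X n \<omega>) (Y n \<omega>)) \<in> borel_measurable M"
    and g: "\<And>K L x y. \<bar>x\<bar> \<le> K \<Longrightarrow> \<bar>y\<bar> \<le> L \<Longrightarrow> \<bar>g x y\<bar> \<le> b K L"
  shows "tight_seq (\<lambda>n \<omega>. g (X n \<omega>) (Y n \<omega>))"
  unfolding tight_seq_def
proof (intro conjI allI impI meas)
  fix d :: real assume "d > 0"
  then have "d / 2 > 0" by simp
  note [measurable] = tight_seq_measurable[OF X] tight_seq_measurable[OF Y] meas
  obtain K where K: "\<forall>\<^sub>F n in sequentially. prob {\<omega> \<in> space M. K < \<bar>X n \<omega>\<bar>} \<le> d / 2"
    using tight_seqD[OF X \<open>d / 2 > 0\<close>] .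
  obtain L where L: "\<forall>\<^sub>F n in sequentially. prob {\<omega> \<in> space M. L < \<bar>Y n \<omega>\<bar>} \<le> d / 2"
    using tight_seqD[OF Y \<open>d / 2 > 0\<close>] .
  have *: "prob {\<omega> \<in> space M. b K L < \<bar>g (X n \<omega>) (Y n \<omega>)\<bar>} \<le>
      prob {\<omega> \<in> space M. K < \<bar>X n \<omega>\<bar>} + prob {\<omega> \<in> space M. L < \<bar>Y n \<omega>\<bar>}" for n
    by (rule prob_le_add) (use g[of _ K _ L] in \<open>auto simp: not_less [symmetric]\<close>)
  have "\<forall>\<^sub>F n in sequentially. prob {\<omega> \<in> space M. b K L < \<bar>g (X n \<omega>) (Y n \<omega>)\<bar>} \<le> d"
    using K L by eventually_elim (use * in \<open>smt (verit) field_sum_of_halves\<close>)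
  then show "\<exists>K. \<forall>\<^sub>F n in sequentially. prob {\<omega> \<in> space M. K < \<bar>g (X n \<omega>) (Y n \<omega>)\<bar>} \<le> d" ..
qed

lemma tight_seq_add: "tight_seq X \<Longrightarrow> tight_seq Y \<Longrightarrow> tight_seq (\<lambda>n \<omega>. X n \<omega> + Y n \<omega>)"
  by (rule tight_seq_comp2[where g = "(+)" and b = "(+)"])
     (auto intro!: borel_measurable_add simp: tight_seq_measurable)

lemma tight_seq_mult: "tight_seq X \<Longrightarrow> tight_seq Y \<Longrightarrow> tight_seq (\<lambda>n \<omega>. X n \<omega> * Y n \<omega>)"
  by (rule tight_seq_comp2[where g = "(*)" and b = "\<lambda>K L. \<bar>K\<bar> * \<bar>L\<bar>"])
     (auto intro!: borel_measurable_times mult_mono simp: tight_seq_measurable abs_mult)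

lemma tight_seq_cmult: "tight_seq X \<Longrightarrow> tight_seq (\<lambda>n \<omega>. c * X n \<omega>)"
  using tight_seq_mult[OF tight_seq_conv_prob[OF conv_prob_const]] by blast

lemma tight_seq_sum:
  "(\<And>s. s \<in> A \<Longrightarrow> tight_seq (X s)) \<Longrightarrow> tight_seq (\<lambda>n \<omega>. \<Sum>s\<in>A. X s n \<omega>)"
  by (induction A rule: infinite_finite_induct)
     (auto intro: tight_seq_conv_prob[OF conv_prob_const] tight_seq_add)

text \<open>If \<open>\<bar>V\<bar> \<le> K\<close>, a product above \<open>e\<close> forces
  \<open>\<bar>X\<bar>\<close> above \<open>e / K\<close>, which becomes improbable; the remaining
  event has small probability by tightness.\<close>

lemma conv_prob_0_mult_tight:
  assumes X: "conv_prob X 0" and V: "tight_seq V"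
  shows "conv_prob (\<lambda>n \<omega>. X n \<omega> * V n \<omega>) 0"
proof -
  note [measurable] = conv_prob_measurable[OF X] tight_seq_measurable[OF V]
  have "(\<lambda>n. prob {\<omega> \<in> space M. e < \<bar>X n \<omega> * V n \<omega>\<bar>}) \<longlonglongrightarrow> 0" if "e > 0" for e
  proof (rule order_tendstoI)
    fix d :: real assume "0 < d"
    then have "d / 2 > 0" by simp
    obtain K where "K > 0" and K: "\<forall>\<^sub>F n in sequentially. prob {\<omega> \<in> space M. K < \<bar>V n \<omega>\<bar>} \<le> d / 2"
      using tight_seqD[OF V \<open>d / 2 > 0\<close>] .
    have eK: "\<forall>\<^sub>F n in sequentially. prob {\<omega> \<in> space M. e / K < \<bar>X n \<omega>\<bar>} < d / 2"
      using order_tendstoD(2)[OF conv_probD[OF X, of "e / K"] \<open>d / 2 > 0\<close>] \<open>e > 0\<close> \<open>K > 0\<close> by simp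
    have split: "prob {\<omega> \<in> space M. e < \<bar>X n \<omega> * V n \<omega>\<bar>} \<le>
        prob {\<omega> \<in> space M. e / K < \<bar>X n \<omega>\<bar>} + prob {\<omega> \<in> space M. K < \<bar>V n \<omega>\<bar>}" for n
    proof -
      have "\<bar>x * v\<bar> \<le> e" if "\<bar>x\<bar> \<le> e / K" "\<bar>v\<bar> \<le> K" for x v
        using mult_mono[OF that] \<open>K > 0\<close> that by (simp add: abs_mult)
      then show ?thesis
        by (intro prob_le_add) (auto simp: not_less [symmetric])
    qed
    show "\<forall>\<^sub>F n in sequentially. prob {\<omega> \<in> space M. e < \<bar>X n \<omega> * V n \<omega>\<bar>} < d"
      using eK K by eventually_elim (use split in \<open>smt (verit) field_sum_of_halves\<close>)
  next
    fix d :: real assume "d < 0"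
    then show "\<forall>\<^sub>F n in sequentially. d < prob {\<omega> \<in> space M. e < \<bar>X n \<omega> * V n \<omega>\<bar>}"
      by (auto intro!: always_eventually less_le_trans[OF _ measure_nonneg])
  qed
  then show ?thesis by (simp add: conv_prob_def)
qed

end

section \<open>Weak convergence under continuous maps and under perturbations vanishing in
  probability\<close>

lemma isCont_cts_step:
  assumes "a < b"
  shows "isCont (cts_step a b) x"
  using uniformly_continuous_imp_continuous[OF cts_step_uniformly_continuous[OF assms]]
  by (simp add: continuous_on_eq_continuous_at)

lemma cts_step_bounds: "a < b \<Longrightarrow> 0 \<le> cts_step a b x \<and> cts_step a b x \<le> 1"
  by (auto simp: cts_step_def)

text \<open>A bounded continuous test function composed with \<open>g\<close> is again bounded and
  continuous, so convergence of integrals carries over; piecewise linear steps suffice as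
  tests.\<close>

lemma weak_conv_m_continuous_map:
  assumes \<mu>: "\<And>n. real_distribution (\<mu> n)" and L: "real_distribution L" and conv: "weak_conv_m \<mu> L"
    and g: "\<And>x. isCont g x"
  shows "weak_conv_m (\<lambda>n. distr (\<mu> n) borel g) (distr L borel g)"
proof -
  interpret \<mu>: real_distribution "\<mu> n" for n by fact
  interpret L: real_distribution L by fact
  have g_meas: "g \<in> borel_measurable borel"
    by (intro borel_measurable_continuous_onI continuous_at_imp_continuous_on) (use g in auto)
  then have gm: "g \<in> borel_measurable (\<mu> n)" "g \<in> borel_measurable L" for n
    by (simp_all cong: measurable_cong_sets)
  show ?thesis
  proof (rule integral_cts_step_conv_imp_weak_conv)
    show "real_distribution (distr (\<mu> n) borel g)" for n
      by (rule \<mu>.real_distribution_distr[OF gm(1)])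
    show "real_distribution (distr L borel g)"
      by (rule L.real_distribution_distr[OF gm(2)])
    fix x y :: real assume "x < y"
    have c: "isCont (cts_step x y) z" for z by (rule isCont_cts_step[OF \<open>x < y\<close>])
    have cm: "cts_step x y \<in> borel_measurable borel"
      by (intro borel_measurable_continuous_onI continuous_at_imp_continuous_on) (use c in auto)
    have "(\<lambda>n. \<integral>z. cts_step x y (g z) \<partial>\<mu> n) \<longlonglongrightarrow> (\<integral>z. cts_step x y (g z) \<partial>L)"
      by (rule weak_conv_imp_integral_bdd_continuous_conv[OF \<mu> L conv, where B = 1])
         (auto intro!: isCont_o2[OF g c] simp: cts_step_bounds[OF \<open>x < y\<close>] abs_of_nonneg)
    then show "(\<lambda>n. integral\<^sup>L (distr (\<mu> n) borel g) (cts_step x y)) \<longlonglongrightarrow>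
        integral\<^sup>L (distr L borel g) (cts_step x y)"
      by (simp add: integral_distr gm cm)
  qed
qed

text \<open>The step functions used as tests are uniformly continuous with values in [0, 1]. Where
  the two sequences are close, the test values differ by less than \<open>e / 2\<close>; elsewhere
  they differ by at most 1, on an event of vanishing probability.\<close>

lemma (in prob_space) weak_conv_m_slutsky:
  assumes Y: "\<And>n. Y n \<in> borel_measurable M" and X: "\<And>n. X n \<in> borel_measurable M"
    and L: "real_distribution L" and conv: "weak_conv_m (\<lambda>n. distr M borel (Y n)) L"
    and diff: "conv_prob (\<lambda>n \<omega>. X n \<omega> - Y n \<omega>) 0"
  shows "weak_conv_m (\<lambda>n. distr M borel (X n)) L"
proof (rule integral_cts_step_conv_imp_weak_conv)
  note [measurable] = X Y
  show "real_distribution (distr M borel (X n))" for n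
    by (rule real_distribution_distr) simp
  show "real_distribution L" by fact
  fix x y :: real assume "x < y"
  have [measurable]: "cts_step x y \<in> borel_measurable borel"
    by (intro borel_measurable_continuous_onI continuous_at_imp_continuous_on)
       (use isCont_cts_step[OF \<open>x < y\<close>] in auto)
  note bnd = cts_step_bounds[OF \<open>x < y\<close>]
  have int: "integrable M (\<lambda>\<omega>. cts_step x y (U \<omega>))" if "U \<in> borel_measurable M" for U
    using that bnd by (intro integrable_const_bound[of _ 1]) (auto simp: abs_of_nonneg)
  have Yc: "(\<lambda>n. \<integral>z. cts_step x y z \<partial>distr M borel (Y n)) \<longlonglongrightarrow> (\<integral>z. cts_step x y z \<partial>L)"
    by (rule weak_conv_imp_integral_bdd_continuous_conv[OF _ L conv, where B = 1])
       (auto intro!: isCont_cts_step[OF \<open>x < y\<close>] real_distribution_distr simp: bnd abs_of_nonneg)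
  have "(\<lambda>n. (\<integral>\<omega>. cts_step x y (X n \<omega>) \<partial>M) - (\<integral>\<omega>. cts_step x y (Y n \<omega>) \<partial>M)) \<longlonglongrightarrow> 0"
  proof (rule tendstoI)
    fix e :: real assume "e > 0"
    obtain d where "d > 0" and d: "\<And>u v. \<bar>u - v\<bar> < d \<Longrightarrow> \<bar>cts_step x y u - cts_step x y v\<bar> < e / 2"
      using cts_step_uniformly_continuous[OF \<open>x < y\<close>] \<open>e > 0\<close>
      unfolding uniformly_continuous_on_def by (metis UNIV_I dist_real_def half_gt_zero)
    let ?B = "\<lambda>n. {\<omega> \<in> space M. d / 2 < \<bar>X n \<omega> - Y n \<omega>\<bar>}"
    have "(\<lambda>n. prob (?B n)) \<longlonglongrightarrow> 0"
      using conv_probD[OF diff, of "d / 2"] \<open>d > 0\<close> by simp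
    then have "\<forall>\<^sub>F n in sequentially. prob (?B n) < e / 2"
      by (rule order_tendstoD) (use \<open>e > 0\<close> in simp)
    moreover have "\<bar>(\<integral>\<omega>. cts_step x y (X n \<omega>) \<partial>M) - (\<integral>\<omega>. cts_step x y (Y n \<omega>) \<partial>M)\<bar> \<le> e / 2 + prob (?B n)" for n
    proof -
      have "\<bar>(\<integral>\<omega>. cts_step x y (X n \<omega>) \<partial>M) - (\<integral>\<omega>. cts_step x y (Y n \<omega>) \<partial>M)\<bar>
          = \<bar>\<integral>\<omega>. cts_step x y (X n \<omega>) - cts_step x y (Y n \<omega>) \<partial>M\<bar>"
        using int X Y by simp
      also have "\<dots> \<le> (\<integral>\<omega>. \<bar>cts_step x y (X n \<omega>) - cts_step x y (Y n \<omega>)\<bar> \<partial>M)"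
        by simp
      also have "\<dots> \<le> (\<integral>\<omega>. e / 2 + indicator (?B n) \<omega> \<partial>M)"
      proof (rule integral_mono)
        show "integrable M (\<lambda>\<omega>. \<bar>cts_step x y (X n \<omega>) - cts_step x y (Y n \<omega>)\<bar>)"
          using int X Y by auto
        show "integrable M (\<lambda>\<omega>. e / 2 + indicator (?B n) \<omega> :: real)"
          by (auto simp: emeasure_eq_measure)
        fix \<omega> assume "\<omega> \<in> space M"
        show "\<bar>cts_step x y (X n \<omega>) - cts_step x y (Y n \<omega>)\<bar> \<le> e / 2 + indicator (?B n) \<omega>"
        proof (cases "\<omega> \<in> ?B n")
          case True
          then show ?thesis using bnd[of "X n \<omega>"] bnd[of "Y n \<omega>"] \<open>e > 0\<close> by (simp add: abs_le_iff)
        next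
          case False
          then have "\<bar>X n \<omega> - Y n \<omega>\<bar> < d" using \<open>\<omega> \<in> space M\<close> \<open>d > 0\<close> by simp
          then show ?thesis using d False by (simp add: less_imp_le)
        qed
      qed
      also have "\<dots> = e / 2 + prob (?B n)"
        by (subst Bochner_Integration.integral_add) (auto simp: emeasure_eq_measure prob_space)
      finally show ?thesis .
    qed
    ultimately show "\<forall>\<^sub>F n in sequentially.
        dist ((\<integral>\<omega>. cts_step x y (X n \<omega>) \<partial>M) - (\<integral>\<omega>. cts_step x y (Y n \<omega>) \<partial>M)) 0 < e"
      by (elim eventually_mono) (simp add: dist_real_def, smt (verit) field_sum_of_halves)
  qed
  from tendsto_add[OF this Yc]
  show "(\<lambda>n. integral\<^sup>L (distr M borel (X n)) (cts_step x y)) \<longlonglongrightarrow> integral\<^sup>L L (cts_step x y)"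
    by (simp add: integral_distr)
qed

section \<open>Random sums\<close>

text \<open>The library's \<open>indep_var\<close> forces both random variables to have the same type.\<close>

definition (in prob_space) indep_pair :: "'b measure \<Rightarrow> ('a \<Rightarrow> 'b) \<Rightarrow> 'c measure \<Rightarrow> ('a \<Rightarrow> 'c) \<Rightarrow> bool" where
  "indep_pair S X T Y \<longleftrightarrow> X \<in> measurable M S \<and> Y \<in> measurable M T \<and>
     (\<forall>A\<in>sets S. \<forall>B\<in>sets T. prob (X -` A \<inter> Y -` B \<inter> space M) = prob (X -` A \<inter> space M) * prob (Y -` B \<inter> space M))"

lemma (in prob_space) indep_pair_compose:
  assumes ind: "indep_pair S X T Y" and f: "f \<in> measurable S S'" and g: "g \<in> measurable T T'"
  shows "indep_pair S' (\<lambda>\<omega>. f (X \<omega>)) T' (\<lambda>\<omega>. g (Y \<omega>))"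
  unfolding indep_pair_def
proof (intro conjI ballI)
  have X: "X \<in> measurable M S" and Y: "Y \<in> measurable M T"
    using ind by (auto simp: indep_pair_def)
  show "(\<lambda>\<omega>. f (X \<omega>)) \<in> measurable M S'" "(\<lambda>\<omega>. g (Y \<omega>)) \<in> measurable M T'"
    using measurable_compose[OF X f] measurable_compose[OF Y g] .
  fix A B assume A: "A \<in> sets S'" and B: "B \<in> sets T'"
  have "(\<lambda>\<omega>. f (X \<omega>)) -` A \<inter> space M = X -` (f -` A \<inter> space S) \<inter> space M"
    "(\<lambda>\<omega>. g (Y \<omega>)) -` B \<inter> space M = Y -` (g -` B \<inter> space T) \<inter> space M"
    "(\<lambda>\<omega>. f (X \<omega>)) -` A \<inter> (\<lambda>\<omega>. g (Y \<omega>)) -` B \<inter> space M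
      = X -` (f -` A \<inter> space S) \<inter> Y -` (g -` B \<inter> space T) \<inter> space M"
    using measurable_space[OF X] measurable_space[OF Y] by auto
  moreover have "prob (X -` (f -` A \<inter> space S) \<inter> Y -` (g -` B \<inter> space T) \<inter> space M) =
      prob (X -` (f -` A \<inter> space S) \<inter> space M) * prob (Y -` (g -` B \<inter> space T) \<inter> space M)"
    using ind measurable_sets[OF f A] measurable_sets[OF g B] unfolding indep_pair_def by blast
  ultimately show "prob ((\<lambda>\<omega>. f (X \<omega>)) -` A \<inter> (\<lambda>\<omega>. g (Y \<omega>)) -` B \<inter> space M) =
      prob ((\<lambda>\<omega>. f (X \<omega>)) -` A \<inter> space M) * prob ((\<lambda>\<omega>. g (Y \<omega>)) -` B \<inter> space M)"
    by (simp only:)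
qed

text \<open>The joint law agrees with the product law on rectangles, hence everywhere, and Fubini's
  theorem applies. In effect \<open>X\<close> is frozen while \<open>Y\<close> is averaged.
  Banach-valued \<open>H\<close> lets one statement serve complex exponentials and real
  indicators.\<close>

lemma (in prob_space) expectation_indep_pair:
  fixes H :: "'b \<Rightarrow> 'c \<Rightarrow> 'd::{banach, second_countable_topology}"
  assumes ind: "indep_pair S X T Y"
    and H: "(\<lambda>(x, y). H x y) \<in> borel_measurable (S \<Otimes>\<^sub>M T)"
    and bnd: "\<And>x y. norm (H x y) \<le> B"
  shows "(\<integral>\<omega>. H (X \<omega>) (Y \<omega>) \<partial>M) = (\<integral>\<omega>. (\<integral>\<omega>'. H (X \<omega>) (Y \<omega>') \<partial>M) \<partial>M)"
proof -
  have [measurable]: "X \<in> measurable M S" "Y \<in> measurable M T"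
    using ind by (auto simp: indep_pair_def)
  have eq: "distr M S X \<Otimes>\<^sub>M distr M T Y = distr M (S \<Otimes>\<^sub>M T) (\<lambda>\<omega>. (X \<omega>, Y \<omega>))"
  proof (rule pair_measure_eqI)
    show "sigma_finite_measure (distr M S X)" "sigma_finite_measure (distr M T Y)"
      by (auto intro!: prob_space_imp_sigma_finite prob_space_distr)
    fix A B assume A: "A \<in> sets (distr M S X)" and B: "B \<in> sets (distr M T Y)"
    have "(\<lambda>\<omega>. (X \<omega>, Y \<omega>)) -` (A \<times> B) \<inter> space M = X -` A \<inter> Y -` B \<inter> space M" by auto
    with A B ind show "emeasure (distr M S X) A * emeasure (distr M T Y) B
        = emeasure (distr M (S \<Otimes>\<^sub>M T) (\<lambda>\<omega>. (X \<omega>, Y \<omega>))) (A \<times> B)"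
      by (simp add: emeasure_distr emeasure_eq_measure indep_pair_def ennreal_mult'')
  qed simp
  interpret X: prob_space "distr M S X" by (rule prob_space_distr) simp
  interpret Y: prob_space "distr M T Y" by (rule prob_space_distr) simp
  interpret XY: pair_prob_space "distr M S X" "distr M T Y" ..
  have Hm: "(\<lambda>(x, y). H x y) \<in> borel_measurable (distr M S X \<Otimes>\<^sub>M distr M T Y)"
    using H by (simp cong: measurable_cong_sets add: eq)
  have int: "integrable (distr M S X \<Otimes>\<^sub>M distr M T Y) (\<lambda>(x, y). H x y)"
    by (rule XY.P.integrable_const_bound[of _ B]) (use bnd Hm in auto)
  have "(\<integral>\<omega>. H (X \<omega>) (Y \<omega>) \<partial>M) = (\<integral>p. (\<lambda>(x, y). H x y) p \<partial>distr M (S \<Otimes>\<^sub>M T) (\<lambda>\<omega>. (X \<omega>, Y \<omega>)))"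
    using H by (subst integral_distr) auto
  also have "\<dots> = (\<integral>x. (\<integral>y. H x y \<partial>distr M T Y) \<partial>distr M S X)"
    unfolding eq[symmetric] using XY.integral_fst'[OF int] by simp
  also have "\<dots> = (\<integral>\<omega>. (\<integral>y. H (X \<omega>) y \<partial>distr M T Y) \<partial>M)"
  proof (rule integral_distr)
    have "(\<lambda>x. \<integral>y. H x y \<partial>distr M T Y) \<in> borel_measurable (distr M S X)"
      by (rule Y.borel_measurable_lebesgue_integral) (use Hm in \<open>simp cong: measurable_cong_sets\<close>)
    then show "(\<lambda>x. \<integral>y. H x y \<partial>distr M T Y) \<in> borel_measurable S" by simp
  qed simp
  also have "\<dots> = (\<integral>\<omega>. (\<integral>\<omega>'. H (X \<omega>) (Y \<omega>') \<partial>M) \<partial>M)"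
  proof (rule Bochner_Integration.integral_cong[OF refl])
    fix \<omega> assume "\<omega> \<in> space M"
    then have "X \<omega> \<in> space S" by (rule measurable_space[rotated]) simp
    then have "(\<lambda>y. H (X \<omega>) y) \<in> borel_measurable T"
      using measurable_compose[OF measurable_Pair1' H] by simp
    then show "(\<integral>y. H (X \<omega>) y \<partial>distr M T Y) = (\<integral>\<omega>'. H (X \<omega>) (Y \<omega>') \<partial>M)"
      by (subst integral_distr) auto
  qed
  finally show ?thesis .
qed

text \<open>A new term is independent of the sum of the old ones and centred, so the cross term has
  expectation zero and the variances add. Integrability is carried through the induction since the
  next step and Chebyshev's inequality both rely on it.\<close>

lemma (in prob_space) indep_vars_sum_square:
  fixes X :: "'i \<Rightarrow> 'a \<Rightarrow> real" and v :: real
  assumes "finite A" and ind: "indep_vars (\<lambda>_. borel) X A"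
    and sq: "\<And>k. k \<in> A \<Longrightarrow> integrable M (\<lambda>\<omega>. (X k \<omega>)\<^sup>2)"
    and mean: "\<And>k. k \<in> A \<Longrightarrow> expectation (X k) = 0"
    and var: "\<And>k. k \<in> A \<Longrightarrow> expectation (\<lambda>\<omega>. (X k \<omega>)\<^sup>2) = v"
  shows "integrable M (\<lambda>\<omega>. (\<Sum>k\<in>A. X k \<omega>)\<^sup>2) \<and> expectation (\<lambda>\<omega>. \<Sum>k\<in>A. X k \<omega>) = 0 \<and>
    expectation (\<lambda>\<omega>. (\<Sum>k\<in>A. X k \<omega>)\<^sup>2) = card A * v"
  using assms
proof (induction A rule: finite_induct)
  case empty
  then show ?case by simp
next
  case (insert a A)
  let ?S = "\<lambda>\<omega>. \<Sum>k\<in>A. X k \<omega>"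
  have IH: "integrable M (\<lambda>\<omega>. (?S \<omega>)\<^sup>2)" "expectation ?S = 0" "expectation (\<lambda>\<omega>. (?S \<omega>)\<^sup>2) = card A * v"
    using insert.IH indep_vars_subset[OF insert.prems(1)] insert.prems by auto
  have ind: "indep_var borel (X a) borel ?S"
    using indep_vars_sum[OF insert.hyps insert.prems(1)] .
  have m: "X a \<in> borel_measurable M" "?S \<in> borel_measurable M"
    using indep_var_rv1[OF ind] indep_var_rv2[OF ind] .
  have i1: "integrable M (X a)" and i2: "integrable M ?S"
    using square_integrable_imp_integrable[OF m(1)] square_integrable_imp_integrable[OF m(2)] insert.prems(2) IH(1)
    by auto
  have i3: "integrable M (\<lambda>\<omega>. X a \<omega> * ?S \<omega>)"
    by (rule indep_var_integrable[OF ind i1 i2])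
  have e3: "expectation (\<lambda>\<omega>. X a \<omega> * ?S \<omega>) = 0"
    using indep_var_lebesgue_integral[OF ind i1 i2] IH(2) by simp
  have eq: "(\<Sum>k\<in>insert a A. X k \<omega>)\<^sup>2 = (X a \<omega>)\<^sup>2 + (?S \<omega>)\<^sup>2 + 2 * (X a \<omega> * ?S \<omega>)" for \<omega>
    using insert.hyps by (simp add: power2_sum)
  show ?case
    unfolding eq using insert i1 i2 i3 e3 IH
    by (simp add: algebra_simps)
qed

text \<open>The number of terms is discrete, so it is enough to look at each fixed
  \<open>n\<close>.\<close>

lemma sum_first_measurable [measurable]:
  "(\<lambda>(n, x). \<Sum>k = 1..n. x k) \<in> borel_measurable (count_space UNIV \<Otimes>\<^sub>M PiM {1::nat..} (\<lambda>_. borel :: real measure))"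
  by (rule measurable_pair_measure_countable1) (auto intro!: borel_measurable_sum measurable_component_singleton)

text \<open>\<open>N\<close> is independent of the whole sequence of summands, taken as one random
  element of the product space; the restriction to \<open>{1..}\<close> makes it a point of that
  space, whose elements are undefined off the index set.\<close>

locale compound_sum = prob_space +
  fixes N :: "'a \<Rightarrow> nat" and X :: "nat \<Rightarrow> 'a \<Rightarrow> real"
  assumes indep_N_X: "indep_pair (count_space UNIV) N (PiM {1..} (\<lambda>_. borel)) (\<lambda>\<omega>. restrict (\<lambda>k. X k \<omega>) {1..})"
    and indep_X: "indep_vars (\<lambda>_. borel) X {1..}"
    and ident_X: "1 \<le> k \<Longrightarrow> distr M borel (X k) = distr M borel (X 1)"
begin

lemma measurable_N [measurable]: "N \<in> measurable M (count_space UNIV)"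
  using indep_N_X by (simp add: indep_pair_def)

lemma measurable_X: "1 \<le> k \<Longrightarrow> X k \<in> borel_measurable M"
  using indep_X by (auto simp: indep_vars_def)

lemma sum_restrict: "(\<Sum>k = 1..n. restrict (\<lambda>k. X k \<omega>) {1..} k) = (\<Sum>k = 1..n. X k \<omega>)"
  by (intro sum.cong) auto

lemma measurable_compound_sum: "(\<lambda>\<omega>. \<Sum>k = 1..N \<omega>. X k \<omega>) \<in> borel_measurable M"
proof -
  have [measurable]: "(\<lambda>\<omega>. restrict (\<lambda>k. X k \<omega>) {1..}) \<in> measurable M (PiM {1..} (\<lambda>_. borel))"
    using indep_N_X by (simp add: indep_pair_def)
  have "(\<lambda>\<omega>. (\<lambda>(n, x). \<Sum>k = 1..n. x k) (N \<omega>, restrict (\<lambda>k. X k \<omega>) {1..})) \<in> borel_measurable M"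
    by measurable
  then show ?thesis by (simp only: prod.case sum_restrict)
qed

text \<open>Conditioning on \<open>N\<close>: the number of terms is taken at \<omega> and the terms
  at an independent copy \<omega>'.\<close>

lemma expectation_compound:
  fixes h :: "real \<Rightarrow> 'd::{banach, second_countable_topology}"
  assumes [measurable]: "h \<in> borel_measurable borel" and "\<And>x. norm (h x) \<le> B"
  shows "(\<integral>\<omega>. h (\<Sum>k = 1..N \<omega>. X k \<omega>) \<partial>M) = (\<integral>\<omega>. (\<integral>\<omega>'. h (\<Sum>k = 1..N \<omega>. X k \<omega>') \<partial>M) \<partial>M)"
proof -
  have "(\<lambda>p. h ((\<lambda>(n, x). \<Sum>k = 1..n. x k) p)) \<in> borel_measurable (count_space UNIV \<Otimes>\<^sub>M PiM {1::nat..} (\<lambda>_. borel))"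
    by measurable
  then have "(\<lambda>(n, x). h (\<Sum>k = 1..n. x k)) \<in> borel_measurable (count_space UNIV \<Otimes>\<^sub>M PiM {1::nat..} (\<lambda>_. borel))"
    by (simp add: case_prod_beta')
  from expectation_indep_pair[OF indep_N_X this, of B] assms(2) show ?thesis
    by (simp only: sum_restrict)
qed

lemma char_compound_sum:
  "char (distr M borel (\<lambda>\<omega>. \<Sum>k = 1..N \<omega>. X k \<omega>)) u = (\<integral>\<omega>. char (distr M borel (X 1)) u ^ N \<omega> \<partial>M)"
proof -
  have inner: "(\<integral>\<omega>'. iexp (u * (\<Sum>k = 1..n. X k \<omega>')) \<partial>M) = char (distr M borel (X 1)) u ^ n" for n
  proof -
    have "(\<integral>\<omega>'. iexp (u * (\<Sum>k = 1..n. X k \<omega>')) \<partial>M) = char (distr M borel (\<lambda>\<omega>. \<Sum>k = 1..n. X k \<omega>)) u"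
      unfolding char_def by (subst integral_distr) (auto intro!: borel_measurable_sum measurable_X)
    also have "\<dots> = (\<Prod>k = 1..n. char (distr M borel (X k)) u)"
      by (rule char_distr_sum[OF indep_vars_subset[OF indep_X]]) auto
    also have "\<dots> = (\<Prod>k = 1..n. char (distr M borel (X 1)) u)"
      by (intro prod.cong refl) (subst ident_X, auto)
    finally show ?thesis by simp
  qed
  have "char (distr M borel (\<lambda>\<omega>. \<Sum>k = 1..N \<omega>. X k \<omega>)) u = (\<integral>\<omega>. iexp (u * (\<Sum>k = 1..N \<omega>. X k \<omega>)) \<partial>M)"
    unfolding char_def by (subst integral_distr) (auto intro!: measurable_compound_sum simp del: One_nat_def)
  also have "\<dots> = (\<integral>\<omega>. (\<integral>\<omega>'. iexp (u * (\<Sum>k = 1..N \<omega>. X k \<omega>')) \<partial>M) \<partial>M)"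
    by (rule expectation_compound[where B = 1]) (auto simp flip: of_real_mult)
  finally show ?thesis by (simp only: inner)
qed

text \<open>The cutoff \<open>L\<close> replaces a moment of \<open>N\<close>: given
  \<open>N = n \<le> L\<close>, the sum has variance at most \<open>\<bar>L\<bar>\<close> times that
  of one term, and the case \<open>N > L\<close> is charged with its full probability.\<close>

lemma Chebyshev_compound_sum:
  assumes mean: "expectation (X 1) = 0" and sq: "integrable M (\<lambda>\<omega>. (X 1 \<omega>)\<^sup>2)" and "0 < c"
  shows "prob {\<omega> \<in> space M. c < \<bar>\<Sum>k = 1..N \<omega>. X k \<omega>\<bar>} \<le>
    prob {\<omega> \<in> space M. L < real (N \<omega>)} + \<bar>L\<bar> * expectation (\<lambda>\<omega>. (X 1 \<omega>)\<^sup>2) / c\<^sup>2"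
proof -
  define v where "v = expectation (\<lambda>\<omega>. (X 1 \<omega>)\<^sup>2)"
  have "v \<ge> 0" by (simp add: v_def)
  let ?h = "indicator {x. c < \<bar>x\<bar>} :: real \<Rightarrow> real"
  let ?D = "distr M borel (X 1)"
  have [measurable]: "X 1 \<in> borel_measurable M" by (rule measurable_X) simp
  have moments: "integrable M (\<lambda>\<omega>. (X k \<omega>)\<^sup>2)" "expectation (X k) = 0" "expectation (\<lambda>\<omega>. (X k \<omega>)\<^sup>2) = v" if "1 \<le> k" for k
  proof -
    have [measurable]: "X k \<in> borel_measurable M" by (rule measurable_X[OF that])
    have "integrable (distr M borel (X k)) power2" "(\<integral>x. x \<partial>distr M borel (X k)) = 0"
      "(\<integral>x. x\<^sup>2 \<partial>distr M borel (X k)) = v"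
      unfolding ident_X[OF that] using mean sq by (simp_all add: integrable_distr_eq integral_distr v_def del: One_nat_def)
    then show "integrable M (\<lambda>\<omega>. (X k \<omega>)\<^sup>2)" "expectation (X k) = 0" "expectation (\<lambda>\<omega>. (X k \<omega>)\<^sup>2) = v"
      by (simp_all add: integrable_distr_eq integral_distr)
  qed
  have inner: "(\<integral>\<omega>'. ?h (\<Sum>k = 1..n. X k \<omega>') \<partial>M) \<le> indicator {L<..} (real n) + \<bar>L\<bar> * v / c\<^sup>2" for n
  proof -
    let ?S = "\<lambda>\<omega>. \<Sum>k = 1..n. X k \<omega>"
    have [measurable]: "?S \<in> borel_measurable M" by (intro borel_measurable_sum measurable_X) auto
    have S: "integrable M (\<lambda>\<omega>. (?S \<omega>)\<^sup>2)" "expectation ?S = 0" "expectation (\<lambda>\<omega>. (?S \<omega>)\<^sup>2) = n * v"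
      using indep_vars_sum_square[where A = "{1..n}" and X = X and v = v, OF _ indep_vars_subset[OF indep_X]] moments
      by auto
    have "(\<integral>\<omega>'. ?h (?S \<omega>') \<partial>M) = (\<integral>\<omega>'. indicator {\<omega> \<in> space M. c < \<bar>?S \<omega>\<bar>} \<omega>' \<partial>M)"
      by (intro Bochner_Integration.integral_cong refl) (auto simp: indicator_def)
    also have "\<dots> = prob {\<omega> \<in> space M. c < \<bar>?S \<omega>\<bar>}"
      by (simp add: inf.absorb1 Collect_restrict)
    finally have eq: "(\<integral>\<omega>'. ?h (?S \<omega>') \<partial>M) = prob {\<omega> \<in> space M. c < \<bar>?S \<omega>\<bar>}" .
    show ?thesis
    \<comment> \<open>Here the indicator alone dominates the probability. The modulus of
      \<open>L\<close> keeps the second summand nonnegative for negative \<open>L\<close> as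
      well.\<close>
    proof (cases "L < real n")
      case True
      then show ?thesis using \<open>v \<ge> 0\<close> unfolding eq by (auto intro!: add_increasing2)
    next
      case False
      have "prob {\<omega> \<in> space M. c < \<bar>?S \<omega>\<bar>} \<le> prob {\<omega> \<in> space M. c \<le> \<bar>?S \<omega> - expectation ?S\<bar>}"
        using S(2) by (intro finite_measure_mono) (auto simp del: One_nat_def)
      also have "\<dots> \<le> expectation (\<lambda>\<omega>. (?S \<omega> - expectation ?S)\<^sup>2) / c\<^sup>2"
        by (rule Chebyshev_inequality) (use S \<open>0 < c\<close> in \<open>auto simp del: One_nat_def\<close>)
      also have "\<dots> = n * v / c\<^sup>2" using S by simp
      also have "\<dots> \<le> \<bar>L\<bar> * v / c\<^sup>2"
        using False \<open>v \<ge> 0\<close> by (intro divide_right_mono mult_right_mono) auto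
      finally show ?thesis using eq False by simp
    qed
  qed
  have [measurable]: "(\<lambda>\<omega>. \<Sum>k = 1..N \<omega>. X k \<omega>) \<in> borel_measurable M" by (rule measurable_compound_sum)
  have "prob {\<omega> \<in> space M. c < \<bar>\<Sum>k = 1..N \<omega>. X k \<omega>\<bar>} = (\<integral>\<omega>. indicator {\<omega> \<in> space M. c < \<bar>\<Sum>k = 1..N \<omega>. X k \<omega>\<bar>} \<omega> \<partial>M)"
    by (simp add: inf.absorb1 Collect_restrict)
  also have "\<dots> = (\<integral>\<omega>. ?h (\<Sum>k = 1..N \<omega>. X k \<omega>) \<partial>M)"
    by (intro Bochner_Integration.integral_cong refl) (auto simp: indicator_def)
  also have "\<dots> = (\<integral>\<omega>. (\<integral>\<omega>'. ?h (\<Sum>k = 1..N \<omega>. X k \<omega>') \<partial>M) \<partial>M)"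
    by (rule expectation_compound[where B = 1]) (auto simp: indicator_def)
  also have "\<dots> \<le> (\<integral>\<omega>. indicator {L<..} (real (N \<omega>)) + \<bar>L\<bar> * v / c\<^sup>2 \<partial>M)"
  proof (rule integral_mono)
    show "integrable M (\<lambda>\<omega>. \<integral>\<omega>'. ?h (\<Sum>k = 1..N \<omega>. X k \<omega>') \<partial>M)"
    proof (rule integrable_const_bound[of _ 1])
      show "AE \<omega> in M. norm (\<integral>\<omega>'. ?h (\<Sum>k = 1..N \<omega>. X k \<omega>') \<partial>M) \<le> 1"
      proof (rule AE_I2)
        fix \<omega>
        have "(\<integral>\<omega>'. ?h (\<Sum>k = 1..N \<omega>. X k \<omega>') \<partial>M) \<le> (\<integral>\<omega>'. 1 \<partial>M)"
          by (rule integral_mono_AE') auto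
        then show "norm (\<integral>\<omega>'. ?h (\<Sum>k = 1..N \<omega>. X k \<omega>') \<partial>M) \<le> 1"
          by (simp add: prob_space integral_nonneg_AE)
      qed
      show "(\<lambda>\<omega>. \<integral>\<omega>'. ?h (\<Sum>k = 1..N \<omega>. X k \<omega>') \<partial>M) \<in> borel_measurable M"
        by (rule measurable_compose[OF measurable_N, where g = "\<lambda>n. \<integral>\<omega>'. ?h (\<Sum>k = 1..n. X k \<omega>') \<partial>M"]) simp
    qed
    show "integrable M (\<lambda>\<omega>. indicator {L<..} (real (N \<omega>)) + \<bar>L\<bar> * v / c\<^sup>2)"
      by (intro Bochner_Integration.integrable_add integrable_const_bound[of "\<lambda>\<omega>. indicator {L<..} (real (N \<omega>))" 1])
         (auto simp: indicator_def)
  qed (rule inner)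
  also have "\<dots> = (\<integral>\<omega>. indicator {\<omega> \<in> space M. L < real (N \<omega>)} \<omega> + \<bar>L\<bar> * v / c\<^sup>2 \<partial>M)"
    by (intro Bochner_Integration.integral_cong refl) (auto simp: indicator_def)
  also have "\<dots> = prob {\<omega> \<in> space M. L < real (N \<omega>)} + \<bar>L\<bar> * v / c\<^sup>2"
    by (subst Bochner_Integration.integral_add) (auto simp: emeasure_eq_measure prob_space)
  finally show ?thesis by (simp add: v_def)
qed

end

text \<open>The upper bound comes from \<open>exp (- y) \<le> 1 / (1 + y)\<close> and
  \<open>(1 - y + y^2) * (1 + y) = 1 + y^3 \<ge> 1\<close>. A quadratic error is needed below, where
  \<open>y\<close> is of order \<open>1 / a n\<close> and the error gets multiplied by
  \<open>a n\<close>.\<close>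

lemma abs_exp_minus_linear_le:
  fixes y :: real
  assumes "0 \<le> y"
  shows "\<bar>exp (- y) - (1 - y)\<bar> \<le> y\<^sup>2"
proof -
  have "1 - y \<le> exp (- y)" using exp_ge_add_one_self[of "- y"] by simp
  moreover have "exp (- y) \<le> 1 - y + y\<^sup>2"
  proof -
    have "exp (- y) = 1 / exp y" by (simp add: exp_minus inverse_eq_divide)
    also have "\<dots> \<le> 1 / (1 + y)"
      using assms exp_ge_add_one_self[of y] by (intro divide_left_mono) (auto intro: mult_pos_pos)
    also have "\<dots> \<le> 1 - y + y\<^sup>2"
    proof -
      have "(1 - y + y\<^sup>2) * (1 + y) = 1 + y ^ 3" by (simp add: algebra_simps power2_eq_square power3_eq_cube)
      then show ?thesis using assms by (simp add: divide_le_eq)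
    qed
    finally show ?thesis .
  qed
  ultimately show ?thesis by simp
qed

section \<open>Characteristic functions of random sums\<close>

text \<open>Both functions are compared with the common expansion
  \<open>1 - u^2 * v / (2 * a n)\<close>. The factor \<open>a n\<close> in front anticipates a power
  whose exponent grows like \<open>a n\<close>.\<close>

lemma (in prob_space) char_minus_exp_small:
  fixes X :: "'a \<Rightarrow> real" and a :: "nat \<Rightarrow> real"
  assumes X [measurable]: "X \<in> borel_measurable M" and mean: "expectation X = 0" and sq: "integrable M (\<lambda>\<omega>. (X \<omega>)\<^sup>2)"
    and a: "filterlim a at_top sequentially" and a_pos: "\<And>n. 0 < a n"
  defines "v \<equiv> expectation (\<lambda>\<omega>. (X \<omega>)\<^sup>2)"
  shows "(\<lambda>n. a n * cmod (char (distr M borel X) (u / sqrt (a n)) - exp (- (u\<^sup>2 * v / (2 * a n))))) \<longlonglongrightarrow> 0"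
proof -
  have "v \<ge> 0" by (simp add: v_def)
  have int: "integrable M X" by (rule square_integrable_imp_integrable[OF X sq])
  \<comment> \<open>The remainder of the second-order expansion. Taking the minimum with a multiple
    of the square gives a dominating function without a third moment, while the cubic branch makes
    the integrand tend to zero pointwise.\<close>
  define r where "r n = expectation (\<lambda>\<omega>. min (6 * (X \<omega>)\<^sup>2) (\<bar>u / sqrt (a n)\<bar> * \<bar>X \<omega>\<bar> ^ 3))" for n
  have u0: "(\<lambda>n. \<bar>u / sqrt (a n)\<bar>) \<longlonglongrightarrow> 0"
    by (rule tendsto_rabs_zero, rule tendsto_divide_0[OF tendsto_const],
        rule filterlim_at_top_imp_at_infinity, rule filterlim_compose[OF sqrt_at_top a])
  have "r \<longlonglongrightarrow> (\<integral>\<omega>. 0 \<partial>M)"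
    unfolding r_def
  proof (rule integral_dominated_convergence[where w = "\<lambda>\<omega>. 6 * (X \<omega>)\<^sup>2"])
    show "AE \<omega> in M. (\<lambda>n. min (6 * (X \<omega>)\<^sup>2) (\<bar>u / sqrt (a n)\<bar> * \<bar>X \<omega>\<bar> ^ 3)) \<longlonglongrightarrow> 0"
    proof (rule AE_I2)
      fix \<omega>
      have "(\<lambda>n. min (6 * (X \<omega>)\<^sup>2) (\<bar>u / sqrt (a n)\<bar> * \<bar>X \<omega>\<bar> ^ 3)) \<longlonglongrightarrow> min (6 * (X \<omega>)\<^sup>2) (0 * \<bar>X \<omega>\<bar> ^ 3)"
        by (intro tendsto_min tendsto_const tendsto_mult u0)
      then show "(\<lambda>n. min (6 * (X \<omega>)\<^sup>2) (\<bar>u / sqrt (a n)\<bar> * \<bar>X \<omega>\<bar> ^ 3)) \<longlonglongrightarrow> 0" by simp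
    qed
  qed (use sq in auto)
  then have r0: "r \<longlonglongrightarrow> 0" by simp
  have bound: "a n * cmod (char (distr M borel X) (u / sqrt (a n)) - exp (- (u\<^sup>2 * v / (2 * a n)))) \<le>
      u\<^sup>2 / 6 * r n + u ^ 4 * v\<^sup>2 / 4 * inverse (a n)" for n
  proof -
    let ?t = "u / sqrt (a n)" and ?y = "u\<^sup>2 * v / (2 * a n)"
    have t2: "?t\<^sup>2 = u\<^sup>2 / a n" using a_pos[of n] by (simp add: power_divide)
    have "cmod (char (distr M borel X) ?t - (1 - ?t\<^sup>2 * v / 2)) \<le> ?t\<^sup>2 / 6 * r n"
      unfolding r_def by (rule char_approx3') (use int sq mean in \<open>auto simp: v_def\<close>)
    then have 1: "cmod (char (distr M borel X) ?t - complex_of_real (1 - ?y)) \<le> u\<^sup>2 / a n / 6 * r n"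
      unfolding t2 by (simp add: mult.commute)
    have "cmod (complex_of_real (1 - ?y) - complex_of_real (exp (- ?y))) = \<bar>exp (- ?y) - (1 - ?y)\<bar>"
      by (simp only: norm_of_real abs_minus_commute flip: of_real_diff)
    also have "\<dots> \<le> ?y\<^sup>2"
      by (rule abs_exp_minus_linear_le) (use \<open>v \<ge> 0\<close> a_pos[of n] in auto)
    finally have 2: "cmod (complex_of_real (1 - ?y) - complex_of_real (exp (- ?y))) \<le> ?y\<^sup>2" .
    have "cmod (char (distr M borel X) ?t - complex_of_real (exp (- ?y))) \<le> u\<^sup>2 / a n / 6 * r n + ?y\<^sup>2"
      using norm_triangle_mono[OF 1 2] by simp
    then have "a n * cmod (char (distr M borel X) ?t - complex_of_real (exp (- ?y))) \<le> a n * (u\<^sup>2 / a n / 6 * r n + ?y\<^sup>2)"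
      using a_pos[of n] by (intro mult_left_mono) auto
    also have "\<dots> = u\<^sup>2 / 6 * r n + u ^ 4 * v\<^sup>2 / 4 * inverse (a n)"
      using a_pos[of n] by (simp add: field_simps power2_eq_square eval_nat_numeral)
    finally show ?thesis by (simp flip: exp_of_real)
  qed
  have "(\<lambda>n. u\<^sup>2 / 6 * r n + u ^ 4 * v\<^sup>2 / 4 * inverse (a n)) \<longlonglongrightarrow> u\<^sup>2 / 6 * 0 + u ^ 4 * v\<^sup>2 / 4 * 0"
    by (intro tendsto_intros r0 tendsto_inverse_0_at_top a)
  then have lim: "(\<lambda>n. u\<^sup>2 / 6 * r n + u ^ 4 * v\<^sup>2 / 4 * inverse (a n)) \<longlonglongrightarrow> 0" by simp
  show ?thesis
    by (rule tendsto_sandwich[OF _ _ tendsto_const lim])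
       (use bound a_pos in \<open>auto intro!: always_eventually mult_nonneg_nonneg simp: less_imp_le\<close>)
qed

text \<open>After replacing the characteristic function by the normal exponential, the power depends
  on the random exponent through \<open>N n / a n\<close> only, which converges almost surely. All
  powers lie in the unit disc, so the constant 1 dominates.\<close>

lemma (in prob_space) char_power_random_tendsto:
  fixes X :: "'a \<Rightarrow> real" and a :: "nat \<Rightarrow> real" and N :: "nat \<Rightarrow> 'a \<Rightarrow> nat"
  assumes X [measurable]: "X \<in> borel_measurable M" and mean: "expectation X = 0" and sq: "integrable M (\<lambda>\<omega>. (X \<omega>)\<^sup>2)"
    and a: "filterlim a at_top sequentially" and a_pos: "\<And>n. 0 < a n"
    and N [measurable]: "\<And>n. N n \<in> measurable M (count_space UNIV)"
    and lim: "AE \<omega> in M. (\<lambda>n. real (N n \<omega>) / a n) \<longlonglongrightarrow> l"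
  defines "v \<equiv> expectation (\<lambda>\<omega>. (X \<omega>)\<^sup>2)"
  shows "(\<lambda>n. \<integral>\<omega>. char (distr M borel X) (u / sqrt (a n)) ^ N n \<omega> \<partial>M) \<longlonglongrightarrow> exp (- (l * v * u\<^sup>2 / 2))"
proof -
  have "v \<ge> 0" by (simp add: v_def)
  interpret D: real_distribution "distr M borel X" by (rule real_distribution_distr) simp
  let ?z = "\<lambda>n. char (distr M borel X) (u / sqrt (a n))"
  let ?y = "\<lambda>n. u\<^sup>2 * v / (2 * a n)"
  let ?w = "\<lambda>n. complex_of_real (exp (- ?y n))"
  have d0: "(\<lambda>n. a n * cmod (?z n - ?w n)) \<longlonglongrightarrow> 0"
    using char_minus_exp_small[OF X mean sq a a_pos, of u] by (simp add: v_def flip: exp_of_real)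
  have "(\<lambda>n. \<integral>\<omega>. ?z n ^ N n \<omega> \<partial>M) \<longlonglongrightarrow> (\<integral>\<omega>. complex_of_real (exp (- (l * v * u\<^sup>2 / 2))) \<partial>M)"
  proof (rule integral_dominated_convergence[where w = "\<lambda>_. 1"])
    show "AE \<omega> in M. (\<lambda>n. ?z n ^ N n \<omega>) \<longlonglongrightarrow> complex_of_real (exp (- (l * v * u\<^sup>2 / 2)))"
      using lim
    proof eventually_elim
      fix \<omega> assume l: "(\<lambda>n. real (N n \<omega>) / a n) \<longlonglongrightarrow> l"
      \<comment> \<open>In the closed unit disc, \<open>N\<close>-th powers differ by at most
        \<open>N\<close> times the difference of the bases. Splitting off \<open>a n\<close> leaves
        a convergent factor and a null factor.\<close>
      have b: "cmod (?z n ^ N n \<omega> - ?w n ^ N n \<omega>) \<le> real (N n \<omega>) / a n * (a n * cmod (?z n - ?w n))" for n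
      proof -
        have "cmod (?z n ^ N n \<omega> - ?w n ^ N n \<omega>) \<le> real (N n \<omega>) * cmod (?z n - ?w n)"
          by (rule norm_power_diff)
             (use \<open>v \<ge> 0\<close> a_pos[of n] in \<open>auto simp: D.cmod_char_le_1 simp del: of_real_exp\<close>)
        then show ?thesis using a_pos[of n] by simp
      qed
      have "(\<lambda>n. real (N n \<omega>) / a n * (a n * cmod (?z n - ?w n))) \<longlonglongrightarrow> 0"
        using tendsto_mult[OF l d0] by simp
      then have "(\<lambda>n. ?z n ^ N n \<omega> - ?w n ^ N n \<omega>) \<longlonglongrightarrow> 0"
        by (rule Lim_null_comparison[rotated]) (use b in auto)
      moreover have "(\<lambda>n. ?w n ^ N n \<omega>) \<longlonglongrightarrow> complex_of_real (exp (- (l * v * u\<^sup>2 / 2)))"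
      proof -
        have eq: "?w n ^ N n \<omega> = complex_of_real (exp (- (real (N n \<omega>) / a n * v * u\<^sup>2 / 2)))" for n
          using a_pos[of n] by (simp add: exp_of_nat_mult [symmetric] mult_ac flip: of_real_power del: of_real_exp)
        show ?thesis unfolding eq by (intro tendsto_intros l) auto
      qed
      ultimately show "(\<lambda>n. ?z n ^ N n \<omega>) \<longlonglongrightarrow> complex_of_real (exp (- (l * v * u\<^sup>2 / 2)))"
        by (rule Lim_transform[rotated])
    qed
    show "AE \<omega> in M. norm (?z n ^ N n \<omega>) \<le> 1" for n
      by (auto simp: norm_power intro!: power_le_one D.cmod_char_le_1)
  qed auto
  then show ?thesis by (simp add: prob_space exp_of_real)
qed

section \<open>Limit theorems for claim sums\<close>

text \<open>Marks stay abstract: every sum over claims is then the sum of some function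
  \<open>h\<close> of the marks, and its limit theorems are proved once for all \<open>h\<close>.
  The law \<open>Q\<close> of a mark is shared by all years, whereas the growth rates
  \<open>lam j\<close> may vary.\<close>

locale marked_model = prob_space M for M :: "'a measure" +
  fixes J :: "nat set" and Mc :: "nat \<Rightarrow> real \<Rightarrow> 'a \<Rightarrow> nat" and P :: "nat \<Rightarrow> nat \<Rightarrow> 'a \<Rightarrow> 'b"
    and S :: "'b measure" and Q :: "'b measure" and lam :: "nat \<Rightarrow> real"
  assumes indep_marks: "j \<in> J \<Longrightarrow> indep_vars (\<lambda>k. S) (P j) {1..}"
    and ident_marks: "j \<in> J \<Longrightarrow> 1 \<le> k \<Longrightarrow> distr M S (P j k) = Q"
    and indep_count_marks: "j \<in> J \<Longrightarrow> indep_pair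
       (PiM {0..} (\<lambda>_. count_space UNIV)) (\<lambda>\<omega>. restrict (\<lambda>\<alpha>. Mc j \<alpha> \<omega>) {0..})
       (PiM {1..} (\<lambda>_. S)) (\<lambda>\<omega>. restrict (\<lambda>k. P j k \<omega>) {1..})"
    and indep_years: "indep_vars
       (\<lambda>j. PiM {0..} (\<lambda>_. count_space UNIV) \<Otimes>\<^sub>M PiM {1..} (\<lambda>_. S))
       (\<lambda>j \<omega>. (restrict (\<lambda>\<alpha>. Mc j \<alpha> \<omega>) {0..}, restrict (\<lambda>k. P j k \<omega>) {1..})) J"
    and lam_pos: "j \<in> J \<Longrightarrow> 0 < lam j"
    and count_lim: "j \<in> J \<Longrightarrow> AE \<omega> in M. ((\<lambda>\<alpha>. real (Mc j \<alpha> \<omega>) / \<alpha>) \<longlongrightarrow> lam j) at_top"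
begin

definition CS :: "('b \<Rightarrow> real) \<Rightarrow> nat \<Rightarrow> real \<Rightarrow> 'a \<Rightarrow> real" where
  "CS h j \<alpha> \<omega> = (\<Sum>k = 1..Mc j \<alpha> \<omega>. h (P j k \<omega>))"

lemma measurable_mark: "j \<in> J \<Longrightarrow> 1 \<le> k \<Longrightarrow> P j k \<in> measurable M S"
  using indep_marks[of j] by (auto simp: indep_vars_def)

lemma integrable_mark_iff:
  fixes h :: "'b \<Rightarrow> real"
  assumes "j \<in> J" "h \<in> borel_measurable S"
  shows "integrable M (\<lambda>\<omega>. h (P j 1 \<omega>)) \<longleftrightarrow> integrable Q h"
  using integrable_distr_eq[OF measurable_mark[OF assms(1), of 1] assms(2)] ident_marks[OF assms(1), of 1] by simp

lemma expectation_mark: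
  fixes h :: "'b \<Rightarrow> real"
  assumes "j \<in> J" "h \<in> borel_measurable S"
  shows "(\<integral>\<omega>. h (P j 1 \<omega>) \<partial>M) = (\<integral>p. h p \<partial>Q)"
  using integral_distr[OF measurable_mark[OF assms(1), of 1] assms(2)] ident_marks[OF assms(1), of 1] by simp

lemma compound_sum_mark:
  assumes j: "j \<in> J" and h: "h \<in> borel_measurable S" and "0 \<le> \<alpha>"
  shows "compound_sum M (Mc j \<alpha>) (\<lambda>k \<omega>. h (P j k \<omega>))"
proof unfold_locales
  have f: "(\<lambda>m. m \<alpha>) \<in> measurable (PiM {0..} (\<lambda>_. count_space UNIV)) (count_space UNIV)"
    using \<open>0 \<le> \<alpha>\<close> by (intro measurable_component_singleton) auto
  have g: "(\<lambda>x. restrict (\<lambda>k. h (x k)) {1..}) \<in> measurable (PiM {1..} (\<lambda>_. S)) (PiM {1::nat..} (\<lambda>_. borel))"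
    by (intro measurable_restrict measurable_compose[OF _ h] measurable_component_singleton) auto
  have "(\<lambda>\<omega>. restrict (\<lambda>k. h (restrict (\<lambda>k. P j k \<omega>) {1..} k)) {1..}) = (\<lambda>\<omega>. restrict (\<lambda>k. h (P j k \<omega>)) {1..})"
    by (auto simp: fun_eq_iff restrict_def)
  then show "indep_pair (count_space UNIV) (Mc j \<alpha>) (PiM {1..} (\<lambda>_. borel)) (\<lambda>\<omega>. restrict (\<lambda>k. h (P j k \<omega>)) {1..})"
    using indep_pair_compose[OF indep_count_marks[OF j] f g] \<open>0 \<le> \<alpha>\<close> by simp
  show "indep_vars (\<lambda>_. borel) (\<lambda>k \<omega>. h (P j k \<omega>)) {1..}"
    by (rule indep_vars_compose2[OF indep_marks[OF j]]) (use h in auto)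
  fix k :: nat assume "1 \<le> k"
  have "distr M borel (\<lambda>\<omega>. h (P j k \<omega>)) = distr Q borel h" if "1 \<le> k" for k
    using distr_distr[OF h measurable_mark[OF j that]] ident_marks[OF j that] by (simp add: comp_def)
  then show "distr M borel (\<lambda>\<omega>. h (P j k \<omega>)) = distr M borel (\<lambda>\<omega>. h (P j 1 \<omega>))"
    using \<open>1 \<le> k\<close> by simp
qed

lemma measurable_CS: "j \<in> J \<Longrightarrow> h \<in> borel_measurable S \<Longrightarrow> 0 \<le> \<alpha> \<Longrightarrow> CS h j \<alpha> \<in> borel_measurable M"
  unfolding CS_def[abs_def] by (rule compound_sum.measurable_compound_sum[OF compound_sum_mark])

lemma measurable_count: "j \<in> J \<Longrightarrow> 0 \<le> \<alpha> \<Longrightarrow> Mc j \<alpha> \<in> measurable M (count_space UNIV)"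
  by (rule compound_sum.measurable_N[OF compound_sum_mark, of _ "\<lambda>_. 0"]) auto

text \<open>Each sum is a measurable function of the counts and marks of its own year. The function
  \<open>h\<close> may vary with the year because the final linear term weights the residuals
  differently from year to year.\<close>

lemma indep_vars_CS:
  assumes h: "\<And>j. j \<in> J \<Longrightarrow> h j \<in> borel_measurable S" and "0 \<le> \<alpha>"
  shows "indep_vars (\<lambda>_. borel) (\<lambda>j. CS (h j) j \<alpha>) J"
proof -
  let ?Y = "\<lambda>j (m :: real \<Rightarrow> nat, x :: nat \<Rightarrow> 'b). \<Sum>k = 1..m \<alpha>. h j (x k)"
  have "indep_vars (\<lambda>_. borel) (\<lambda>j \<omega>. ?Y j (restrict (\<lambda>\<alpha>. Mc j \<alpha> \<omega>) {0..}, restrict (\<lambda>k. P j k \<omega>) {1..})) J"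
  proof (rule indep_vars_compose2[OF indep_years])
    fix j assume j: "j \<in> J"
    have f: "(\<lambda>m. m \<alpha>) \<in> measurable (PiM {0..} (\<lambda>_. count_space UNIV)) (count_space (UNIV :: nat set))"
      using \<open>0 \<le> \<alpha>\<close> by (intro measurable_component_singleton) auto
    have g: "(\<lambda>x. restrict (\<lambda>k. h j (x k)) {1..}) \<in> measurable (PiM {1..} (\<lambda>_. S)) (PiM {1::nat..} (\<lambda>_. borel))"
      by (intro measurable_restrict measurable_compose[OF _ h[OF j]] measurable_component_singleton) auto
    have "(\<lambda>p. (fst p \<alpha> :: nat, restrict (\<lambda>k. h j (snd p k)) {1::nat..}))
        \<in> measurable (PiM {0..} (\<lambda>_. count_space UNIV) \<Otimes>\<^sub>M PiM {1..} (\<lambda>_. S))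
            (count_space UNIV \<Otimes>\<^sub>M PiM {1..} (\<lambda>_. borel))"
      by (rule measurable_Pair[OF measurable_compose[OF measurable_fst f] measurable_compose[OF measurable_snd g]])
    from measurable_compose[OF this sum_first_measurable]
    have "(\<lambda>p :: (real \<Rightarrow> nat) \<times> (nat \<Rightarrow> 'b). \<Sum>k = 1..fst p \<alpha>. restrict (\<lambda>k. h j (snd p k)) {1..} k)
        \<in> borel_measurable (PiM {0..} (\<lambda>_. count_space UNIV) \<Otimes>\<^sub>M PiM {1..} (\<lambda>_. S))"
      by simp
    moreover have "(\<Sum>k = 1..fst p \<alpha>. restrict (\<lambda>k. h j (snd p k)) {1..} k) = ?Y j p"
      for p :: "(real \<Rightarrow> nat) \<times> (nat \<Rightarrow> 'b)"
      by (auto simp: case_prod_beta intro!: sum.cong)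
    ultimately show "?Y j \<in> borel_measurable (PiM {0..} (\<lambda>_. count_space UNIV) \<Otimes>\<^sub>M PiM {1..} (\<lambda>_. S))"
      by simp
  qed
  moreover have "?Y j (restrict (\<lambda>\<alpha>. Mc j \<alpha> \<omega>) {0..}, restrict (\<lambda>k. P j k \<omega>) {1..}) = CS (h j) j \<alpha> \<omega>" for j \<omega>
    using \<open>0 \<le> \<alpha>\<close> by (auto simp: CS_def intro!: sum.cong)
  ultimately show ?thesis by simp
qed

lemma CS_diff: "CS (\<lambda>p. h p - g p) j \<alpha> \<omega> = CS h j \<alpha> \<omega> - CS g j \<alpha> \<omega>"
  by (simp add: CS_def sum_subtractf)

lemma CS_cmult: "CS (\<lambda>p. c * h p) j \<alpha> \<omega> = c * CS h j \<alpha> \<omega>"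
  by (simp add: CS_def sum_distrib_left)

lemma CS_const: "CS (\<lambda>p. c) j \<alpha> \<omega> = c * real (Mc j \<alpha> \<omega>)"
  by (simp add: CS_def)

lemma CS_sum: "CS (\<lambda>p. \<Sum>s\<in>A. h s p) j \<alpha> \<omega> = (\<Sum>s\<in>A. CS (h s) j \<alpha> \<omega>)"
  by (simp add: CS_def sum.swap[of _ A])

end

text \<open>A sequence of parameters is what dominated convergence and Levy's continuity theorem
  require. Positivity for every \<open>n\<close> makes all divisions by \<open>a n\<close> and its
  root legitimate.\<close>

locale marked_model_seq = marked_model +
  fixes a :: "nat \<Rightarrow> real"
  assumes a_lim: "filterlim a at_top sequentially" and a_pos: "0 < a n"
begin

lemma count_lim_seq: "j \<in> J \<Longrightarrow> AE \<omega> in M. (\<lambda>n. real (Mc j (a n) \<omega>) / a n) \<longlonglongrightarrow> lam j"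
  using count_lim[of j] by (auto elim!: eventually_mono intro: filterlim_compose[OF _ a_lim])

lemma count_conv_prob:
  assumes j: "j \<in> J"
  shows "conv_prob (\<lambda>n \<omega>. real (Mc j (a n) \<omega>) / a n) (lam j)"
proof (rule conv_prob_AE[OF _ count_lim_seq[OF j]])
  fix n
  have [measurable]: "Mc j (a n) \<in> measurable M (count_space UNIV)"
    by (rule measurable_count[OF j]) (simp add: a_pos less_imp_le)
  show "(\<lambda>\<omega>. real (Mc j (a n) \<omega>) / a n) \<in> borel_measurable M" by measurable
qed

lemma tight_CS:
  assumes j: "j \<in> J" and h: "h \<in> borel_measurable S" and sq: "integrable Q (\<lambda>p. (h p)\<^sup>2)"
    and mean: "(\<integral>p. h p \<partial>Q) = 0"
  shows "tight_seq (\<lambda>n \<omega>. CS h j (a n) \<omega> / sqrt (a n))"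
  unfolding tight_seq_def
proof (intro conjI allI impI)
  fix n
  have "CS h j (a n) \<in> borel_measurable M"
    by (rule measurable_CS[OF j h]) (simp add: a_pos less_imp_le)
  then show "(\<lambda>\<omega>. CS h j (a n) \<omega> / sqrt (a n)) \<in> borel_measurable M" by simp
next
  fix d :: real assume "d > 0"
  define v where "v = (\<integral>p. (h p)\<^sup>2 \<partial>Q)"
  have "v \<ge> 0" by (simp add: v_def)
  \<comment> \<open>Chosen so that the Chebyshev term at cutoff \<open>(lam j + 1) * a n\<close>
    becomes \<open>d / 2 * (v / (v + 1))\<close>. Using \<open>v + 1\<close> in place of
    \<open>v\<close> keeps \<open>R\<close> positive if the variance is zero.\<close>
  define R where "R = sqrt (2 * (lam j + 1) * (v + 1) / d)"
  have l: "lam j > 0" by (rule lam_pos[OF j])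
  have "R > 0" using l \<open>v \<ge> 0\<close> \<open>d > 0\<close> by (simp add: R_def)
  have R2: "R\<^sup>2 = 2 * (lam j + 1) * (v + 1) / d" using l \<open>v \<ge> 0\<close> \<open>d > 0\<close> by (simp add: R_def)
  have h2: "(\<lambda>p. (h p)\<^sup>2) \<in> borel_measurable S" using h by simp
  have bound: "prob {\<omega> \<in> space M. R < \<bar>CS h j (a n) \<omega> / sqrt (a n)\<bar>} \<le>
      prob {\<omega> \<in> space M. 1 < \<bar>real (Mc j (a n) \<omega>) / a n - lam j\<bar>} + d / 2" for n
  proof -
    have a0: "a n > 0" "0 \<le> a n" using a_pos[of n] by auto
    interpret C: compound_sum M "Mc j (a n)" "\<lambda>k \<omega>. h (P j k \<omega>)"
      by (rule compound_sum_mark[OF j h a0(2)])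
    have [measurable]: "Mc j (a n) \<in> measurable M (count_space UNIV)" by (rule C.measurable_N)
    \<comment> \<open>Exceeding this cutoff means that the normalised count is more than 1 above its
      limit, an event of vanishing probability.\<close>
    let ?L = "(lam j + 1) * a n"
    have "prob {\<omega> \<in> space M. R < \<bar>CS h j (a n) \<omega> / sqrt (a n)\<bar>}
        = prob {\<omega> \<in> space M. R * sqrt (a n) < \<bar>\<Sum>k = 1..Mc j (a n) \<omega>. h (P j k \<omega>)\<bar>}"
      using a0 by (simp add: CS_def less_divide_eq)
    also have "\<dots> \<le> prob {\<omega> \<in> space M. ?L < real (Mc j (a n) \<omega>)} + \<bar>?L\<bar> * v / (R * sqrt (a n))\<^sup>2"
      unfolding v_def expectation_mark[OF j h2, symmetric]
      by (rule C.Chebyshev_compound_sum)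
         (use a0 \<open>R > 0\<close> mean sq expectation_mark[OF j h] integrable_mark_iff[OF j h2] in auto)
    also have "\<bar>?L\<bar> * v / (R * sqrt (a n))\<^sup>2 = d / 2 * (v / (v + 1))"
    proof -
      have "r * x * v / (2 * r * w / d * x) = d / 2 * (v / w)" if "0 < r" "0 < x" "0 < w" for r x w :: real
        using that \<open>d > 0\<close> by (simp add: field_simps)
      from this[of "lam j + 1" "a n" "v + 1"] show ?thesis
        using a0 l \<open>v \<ge> 0\<close> by (simp add: power_mult_distrib R2)
    qed
    also have "\<dots> \<le> d / 2" using \<open>v \<ge> 0\<close> \<open>d > 0\<close> by (simp add: divide_le_eq)
    also have "prob {\<omega> \<in> space M. ?L < real (Mc j (a n) \<omega>)} \<le> prob {\<omega> \<in> space M. 1 < \<bar>real (Mc j (a n) \<omega>) / a n - lam j\<bar>}"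
    proof (rule finite_measure_mono)
      have "1 < x / a n - lam j" if "?L < x" for x
        using that a0 by (simp add: field_simps)
      then show "{\<omega> \<in> space M. ?L < real (Mc j (a n) \<omega>)} \<subseteq> {\<omega> \<in> space M. 1 < \<bar>real (Mc j (a n) \<omega>) / a n - lam j\<bar>}"
        by force
    qed measurable
    finally show ?thesis by simp
  qed
  have "\<forall>\<^sub>F n in sequentially. prob {\<omega> \<in> space M. 1 < \<bar>real (Mc j (a n) \<omega>) / a n - lam j\<bar>} < d / 2"
    by (rule order_tendstoD(2)[OF conv_probD[OF count_conv_prob[OF j]]]) (use \<open>d > 0\<close> in auto)
  then have "\<forall>\<^sub>F n in sequentially. prob {\<omega> \<in> space M. R < \<bar>CS h j (a n) \<omega> / sqrt (a n)\<bar>} \<le> d"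
    by eventually_elim (use bound in \<open>smt (verit) field_sum_of_halves\<close>)
  then show "\<exists>K. \<forall>\<^sub>F n in sequentially. prob {\<omega> \<in> space M. K < \<bar>CS h j (a n) \<omega> / sqrt (a n)\<bar>} \<le> d" ..
qed

lemma conv_prob_inverse_sqrt: "conv_prob (\<lambda>n \<omega>. 1 / sqrt (a n)) 0"
  by (rule conv_prob_seq, rule tendsto_divide_0[OF tendsto_const],
      rule filterlim_at_top_imp_at_infinity, rule filterlim_compose[OF sqrt_at_top a_lim])

lemma prob_space_marks: "j \<in> J \<Longrightarrow> prob_space Q"
  using prob_space_distr[OF measurable_mark[of j 1]] ident_marks[of j 1] by simp

lemma sets_marks: "j \<in> J \<Longrightarrow> sets Q = sets S"
  using ident_marks[of j 1] by (metis order.refl sets_distr)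

text \<open>Split \<open>h\<close> into its centred part and its mean \<mu>. The centred sum is
  tight after division by \<open>sqrt (a n)\<close>, so one more such division sends it to zero; the
  mean contributes \<mu> times the normalised count.\<close>

lemma weak_law_CS:
  assumes j: "j \<in> J" and h: "h \<in> borel_measurable S" and sq: "integrable Q (\<lambda>p. (h p)\<^sup>2)"
  shows "conv_prob (\<lambda>n \<omega>. CS h j (a n) \<omega> / a n) (lam j * (\<integral>p. h p \<partial>Q))"
proof -
  interpret Q: prob_space Q by (rule prob_space_marks[OF j])
  define \<mu> where "\<mu> = (\<integral>p. h p \<partial>Q)"
  have hQ: "h \<in> borel_measurable Q" using h sets_marks[OF j] by (simp cong: measurable_cong_sets)
  have int: "integrable Q h" by (rule Q.square_integrable_imp_integrable[OF hQ sq])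
  let ?g = "\<lambda>p. h p - \<mu>"
  have "tight_seq (\<lambda>n \<omega>. CS ?g j (a n) \<omega> / sqrt (a n))"
  proof (rule tight_CS[OF j])
    show "?g \<in> borel_measurable S" using h by simp
    show "integrable Q (\<lambda>p. (?g p)\<^sup>2)" using sq int by (simp add: power2_diff)
    show "(\<integral>p. ?g p \<partial>Q) = 0" using int by (simp add: \<mu>_def Q.prob_space)
  qed
  from conv_prob_add[OF conv_prob_0_mult_tight[OF conv_prob_inverse_sqrt this]
      conv_prob_mult[OF count_conv_prob[OF j] conv_prob_const[of \<mu>]]]
  have "conv_prob (\<lambda>n \<omega>. 1 / sqrt (a n) * (CS ?g j (a n) \<omega> / sqrt (a n)) + real (Mc j (a n) \<omega>) / a n * \<mu>) (0 + lam j * \<mu>)" .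
  moreover have "1 / sqrt (a n) * (CS ?g j (a n) \<omega> / sqrt (a n)) + real (Mc j (a n) \<omega>) / a n * \<mu> = CS h j (a n) \<omega> / a n" for n \<omega>
    using a_pos[of n] by (simp add: CS_diff CS_const field_simps less_imp_le)
  ultimately show ?thesis by (simp add: \<mu>_def)
qed

text \<open>Independence of the years turns the characteristic function into a product of
  random-power expectations. Only the total variance has to be positive; a single year may
  contribute nothing.\<close>

lemma clt_CS:
  assumes K: "K \<subseteq> J" "finite K" and h: "\<And>j. j \<in> J \<Longrightarrow> h j \<in> borel_measurable S"
    and sq: "\<And>j. j \<in> K \<Longrightarrow> integrable Q (\<lambda>p. (h j p)\<^sup>2)" and mean: "\<And>j. j \<in> K \<Longrightarrow> (\<integral>p. h j p \<partial>Q) = 0"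
    and s: "s > 0" "s\<^sup>2 = (\<Sum>j\<in>K. lam j * (\<integral>p. (h j p)\<^sup>2 \<partial>Q))"
  shows "weak_conv_m (\<lambda>n. distr M borel (\<lambda>\<omega>. (\<Sum>j\<in>K. CS (h j) j (a n) \<omega> / sqrt (a n)) / s)) std_normal_distribution"
proof (rule levy_continuity)
  have a0: "0 \<le> a n" for n using a_pos[of n] by simp
  have m: "CS (h j) j (a n) \<in> borel_measurable M" if "j \<in> K" for j n
    using that K by (intro measurable_CS h a0) auto
  show "real_distribution (distr M borel (\<lambda>\<omega>. (\<Sum>j\<in>K. CS (h j) j (a n) \<omega> / sqrt (a n)) / s))" for n
    by (intro real_distribution_distr borel_measurable_divide borel_measurable_sum m) auto
  show "real_distribution std_normal_distribution" by (rule real_dist_normal_dist)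
  fix u
  \<comment> \<open>Both normalisations move into the argument \<open>u / s / sqrt (a n)\<close>, so
    that the factors belong to unscaled sums.\<close>
  have eq: "char (distr M borel (\<lambda>\<omega>. (\<Sum>j\<in>K. CS (h j) j (a n) \<omega> / sqrt (a n)) / s)) u =
     (\<Prod>j\<in>K. \<integral>\<omega>. char (distr M borel (\<lambda>\<omega>. h j (P j 1 \<omega>))) (u / s / sqrt (a n)) ^ Mc j (a n) \<omega> \<partial>M)" for n
  proof -
    have "char (distr M borel (\<lambda>\<omega>. (\<Sum>j\<in>K. CS (h j) j (a n) \<omega> / sqrt (a n)) / s)) u
        = char (distr M borel (\<lambda>\<omega>. \<Sum>j\<in>K. CS (h j) j (a n) \<omega>)) (u / s / sqrt (a n))"
      unfolding char_def
      by (subst (1 2) integral_distr) (auto intro!: borel_measurable_sum borel_measurable_divide m simp: mult_ac simp flip: sum_divide_distrib)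
    also have "\<dots> = (\<Prod>j\<in>K. char (distr M borel (CS (h j) j (a n))) (u / s / sqrt (a n)))"
      by (rule char_distr_sum[OF indep_vars_subset[OF indep_vars_CS[OF h a0] K(1)]])
    also have "\<dots> = (\<Prod>j\<in>K. \<integral>\<omega>. char (distr M borel (\<lambda>\<omega>. h j (P j 1 \<omega>))) (u / s / sqrt (a n)) ^ Mc j (a n) \<omega> \<partial>M)"
    proof (intro prod.cong refl)
      fix j assume "j \<in> K"
      then have j: "j \<in> J" using K by auto
      show "char (distr M borel (CS (h j) j (a n))) (u / s / sqrt (a n)) =
          (\<integral>\<omega>. char (distr M borel (\<lambda>\<omega>. h j (P j 1 \<omega>))) (u / s / sqrt (a n)) ^ Mc j (a n) \<omega> \<partial>M)"
        unfolding CS_def[abs_def] by (rule compound_sum.char_compound_sum[OF compound_sum_mark[OF j h[OF j] a0]])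
    qed
    finally show ?thesis .
  qed
  have "(\<lambda>n. \<Prod>j\<in>K. \<integral>\<omega>. char (distr M borel (\<lambda>\<omega>. h j (P j 1 \<omega>))) (u / s / sqrt (a n)) ^ Mc j (a n) \<omega> \<partial>M)
      \<longlonglongrightarrow> (\<Prod>j\<in>K. complex_of_real (exp (- (lam j * (\<integral>p. (h j p)\<^sup>2 \<partial>Q) * (u / s)\<^sup>2 / 2))))"
  proof (rule tendsto_prod)
    fix j assume "j \<in> K"
    then have j: "j \<in> J" using K by auto
    have h2: "(\<lambda>p. (h j p)\<^sup>2) \<in> borel_measurable S" using h[OF j] by simp
    have X: "(\<lambda>\<omega>. h j (P j 1 \<omega>)) \<in> borel_measurable M"
      by (rule measurable_compose[OF measurable_mark[OF j] h[OF j]]) simp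
    have "(\<lambda>n. \<integral>\<omega>. char (distr M borel (\<lambda>\<omega>. h j (P j 1 \<omega>))) (u / s / sqrt (a n)) ^ Mc j (a n) \<omega> \<partial>M)
        \<longlonglongrightarrow> complex_of_real (exp (- (lam j * expectation (\<lambda>\<omega>. (h j (P j 1 \<omega>))\<^sup>2) * (u / s)\<^sup>2 / 2)))"
      using char_power_random_tendsto[OF X _ _ a_lim a_pos measurable_count[OF j a0] count_lim_seq[OF j], of "u / s"]
        mean[OF \<open>j \<in> K\<close>] sq[OF \<open>j \<in> K\<close>] expectation_mark[OF j h[OF j]] integrable_mark_iff[OF j h2] by simp
    then show "(\<lambda>n. \<integral>\<omega>. char (distr M borel (\<lambda>\<omega>. h j (P j 1 \<omega>))) (u / s / sqrt (a n)) ^ Mc j (a n) \<omega> \<partial>M)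
        \<longlonglongrightarrow> complex_of_real (exp (- (lam j * (\<integral>p. (h j p)\<^sup>2 \<partial>Q) * (u / s)\<^sup>2 / 2)))"
      by (simp only: expectation_mark[OF j h2])
  qed
  also have "(\<Prod>j\<in>K. complex_of_real (exp (- (lam j * (\<integral>p. (h j p)\<^sup>2 \<partial>Q) * (u / s)\<^sup>2 / 2))))
      = complex_of_real (exp (- ((\<Sum>j\<in>K. lam j * (\<integral>p. (h j p)\<^sup>2 \<partial>Q)) * (u / s)\<^sup>2 / 2)))"
    unfolding sum_distrib_right sum_divide_distrib sum_negf[symmetric] exp_sum[OF K(2)] of_real_prod ..
  also have "\<dots> = char std_normal_distribution u"
    unfolding s(2)[symmetric] using s(1) by (simp add: char_std_normal_distribution power_divide exp_of_real)
  finally show "(\<lambda>n. char (distr M borel (\<lambda>\<omega>. (\<Sum>j\<in>K. CS (h j) j (a n) \<omega> / sqrt (a n)) / s)) u)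
      \<longlonglongrightarrow> char std_normal_distribution u"
    by (simp only: eq)
qed

end

section \<open>Linearisation of products\<close>

text \<open>A first-order expansion \<open>X = c + L / r + o(1 / r)\<close> in probability, with
  tight \<open>L\<close>: the input of the delta method.\<close>

definition (in prob_space) asymp_linear ::
    "(nat \<Rightarrow> real) \<Rightarrow> (nat \<Rightarrow> 'a \<Rightarrow> real) \<Rightarrow> real \<Rightarrow> (nat \<Rightarrow> 'a \<Rightarrow> real) \<Rightarrow> bool" where
  "asymp_linear r X c L \<longleftrightarrow> tight_seq L \<and> conv_prob (\<lambda>n \<omega>. r n * (X n \<omega> - c) - L n \<omega>) 0"

context prob_space
begin

lemma asymp_linear_tight:
  assumes "asymp_linear r X c L"
  shows "tight_seq (\<lambda>n \<omega>. r n * (X n \<omega> - c))"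
proof -
  have "tight_seq (\<lambda>n \<omega>. (r n * (X n \<omega> - c) - L n \<omega>) + L n \<omega>)"
    by (rule tight_seq_add) (use assms in \<open>auto simp: asymp_linear_def intro: tight_seq_conv_prob\<close>)
  then show ?thesis by simp
qed

lemma asymp_linear_conv_prob:
  assumes "asymp_linear r X c L" and r: "filterlim r at_top sequentially" "\<And>n. 0 < r n"
  shows "conv_prob X c"
proof -
  have "(\<lambda>n. inverse (r n)) \<longlonglongrightarrow> 0"
    by (rule tendsto_inverse_0_at_top[OF r(1)])
  from conv_prob_add[OF conv_prob_0_mult_tight[OF conv_prob_seq[OF this] asymp_linear_tight[OF assms(1)]] conv_prob_const[of c]]
  moreover have "inverse (r n) * (r n * x) = x" for n x
    using r(2)[of n] by simp
  ultimately show ?thesis by simp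
qed

text \<open>\<open>X * Y - c * d = (Y - d) * (X - c) + d * (X - c) + c * (Y - d)\<close>. Multiplied
  by \<open>r n\<close>, the first product is a null factor times a tight one.\<close>

lemma asymp_linear_mult:
  assumes X: "asymp_linear r X c L" and Y: "asymp_linear r Y d K"
    and r: "filterlim r at_top sequentially" "\<And>n. 0 < r n"
  shows "asymp_linear r (\<lambda>n \<omega>. X n \<omega> * Y n \<omega>) (c * d) (\<lambda>n \<omega>. d * L n \<omega> + c * K n \<omega>)"
  unfolding asymp_linear_def
proof
  show "tight_seq (\<lambda>n \<omega>. d * L n \<omega> + c * K n \<omega>)"
    using X Y by (intro tight_seq_add tight_seq_cmult) (auto simp: asymp_linear_def)
  have "conv_prob (\<lambda>n \<omega>. (Y n \<omega> - d) * (r n * (X n \<omega> - c))) 0"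
    using conv_prob_diff[OF asymp_linear_conv_prob[OF Y r] conv_prob_const[of d]]
    by (intro conv_prob_0_mult_tight asymp_linear_tight[OF X]) simp
  from conv_prob_add[OF this conv_prob_add[OF conv_prob_mult[OF conv_prob_const[of d]]
      conv_prob_mult[OF conv_prob_const[of c]]]] X Y
  have "conv_prob (\<lambda>n \<omega>. (Y n \<omega> - d) * (r n * (X n \<omega> - c)) + (d * (r n * (X n \<omega> - c) - L n \<omega>)
      + c * (r n * (Y n \<omega> - d) - K n \<omega>))) (0 + (d * 0 + c * 0))"
    unfolding asymp_linear_def by blast
  then show "conv_prob (\<lambda>n \<omega>. r n * (X n \<omega> * Y n \<omega> - c * d) - (d * L n \<omega> + c * K n \<omega>)) 0"
    by (simp add: algebra_simps)
qed

text \<open>Logarithmic differentiation: each factor contributes its relative error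
  \<open>L s / c s\<close>, scaled by the whole product. This form is why the limits must be
  nonzero.\<close>

lemma asymp_linear_prod:
  assumes "finite A" and "\<And>s. s \<in> A \<Longrightarrow> asymp_linear r (X s) (c s) (L s)" and "\<And>s. s \<in> A \<Longrightarrow> c s \<noteq> 0"
    and r: "filterlim r at_top sequentially" "\<And>n. 0 < r n"
  shows "asymp_linear r (\<lambda>n \<omega>. \<Prod>s\<in>A. X s n \<omega>) (\<Prod>s\<in>A. c s) (\<lambda>n \<omega>. (\<Prod>s\<in>A. c s) * (\<Sum>s\<in>A. L s n \<omega> / c s))"
  using assms(1-3)
proof (induction A rule: finite_induct)
  case empty
  then show ?case
    by (simp add: asymp_linear_def conv_prob_const tight_seq_conv_prob[OF conv_prob_const])
next
  case (insert t A)
  have "asymp_linear r (\<lambda>n \<omega>. X t n \<omega> * (\<Prod>s\<in>A. X s n \<omega>)) (c t * (\<Prod>s\<in>A. c s))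
      (\<lambda>n \<omega>. (\<Prod>s\<in>A. c s) * L t n \<omega> + c t * ((\<Prod>s\<in>A. c s) * (\<Sum>s\<in>A. L s n \<omega> / c s)))"
    by (rule asymp_linear_mult) (use insert r in auto)
  moreover have "(\<Prod>s\<in>A. c s) * l + c t * ((\<Prod>s\<in>A. c s) * x) = c t * (\<Prod>s\<in>A. c s) * (l / c t + x)" for l x
    using insert.prems(2)[of t] by (simp add: field_simps)
  ultimately show ?case using insert.hyps by simp
qed

end

section \<open>The chain ladder statistic\<close>

definition le_part :: "nat \<Rightarrow> nat \<times> real \<Rightarrow> real" where
  "le_part t p = snd p * (if fst p \<le> t then 1 else 0)"

definition eq_part :: "nat \<Rightarrow> nat \<times> real \<Rightarrow> real" where
  "eq_part t p = snd p * (if fst p = t then 1 else 0)"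

lemma le_part_Suc: "le_part (t + 1) p = le_part t p + eq_part (t + 1) p"
  by (auto simp: le_part_def eq_part_def)

abbreviation (input) mark_space :: "(nat \<times> real) measure" where
  "mark_space \<equiv> count_space UNIV \<Otimes>\<^sub>M borel"

lemma measurable_le_part [measurable]: "le_part t \<in> borel_measurable mark_space"
  unfolding le_part_def[abs_def] by measurable

lemma measurable_eq_part [measurable]: "eq_part t \<in> borel_measurable mark_space"
  unfolding eq_part_def[abs_def] by measurable

locale chain_ladder_model = marked_model M "{1..T}" Mc P mark_space Q lam
  for M :: "'a measure" and T :: nat and Mc and P :: "nat \<Rightarrow> nat \<Rightarrow> 'a \<Rightarrow> nat \<times> real" and Q lam +
  assumes T: "2 \<le> T" and sq_int: "integrable Q (\<lambda>p. (snd p)\<^sup>2)"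
    and dev_pos: "AE p in Q. 1 \<le> fst p"
    and incr_pos: "t \<in> {1..T} \<Longrightarrow> 0 < (\<integral>p. eq_part t p \<partial>Q)"
begin

lemma sets_Q: "sets Q = sets mark_space"
  using ident_marks[of 1 1] T by (metis atLeastAtMost_iff order.refl order.trans one_le_numeral sets_distr)

lemma measurable_Q: "h \<in> borel_measurable mark_space \<Longrightarrow> h \<in> borel_measurable Q"
  using sets_Q by (simp cong: measurable_cong_sets)

sublocale Q: prob_space Q
  using prob_space_distr[OF measurable_mark[of 1 1]] ident_marks[of 1 1] T by simp

definition square_int :: "(nat \<times> real \<Rightarrow> real) \<Rightarrow> bool" where
  "square_int h \<longleftrightarrow> h \<in> borel_measurable mark_space \<and> integrable Q (\<lambda>p. (h p)\<^sup>2)"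

lemma square_int_integrable: "square_int h \<Longrightarrow> integrable Q h"
  unfolding square_int_def by (auto intro: Q.square_integrable_imp_integrable measurable_Q)

lemma square_int_mult:
  assumes "square_int h" "square_int g"
  shows "integrable Q (\<lambda>p. h p * g p)"
proof (rule Bochner_Integration.integrable_bound)
  show "integrable Q (\<lambda>p. (h p)\<^sup>2 + (g p)\<^sup>2)"
    using assms by (auto simp: square_int_def)
  show "(\<lambda>p. h p * g p) \<in> borel_measurable Q"
    using assms by (intro measurable_Q) (auto simp: square_int_def)
  have "\<bar>x * y\<bar> \<le> x\<^sup>2 + y\<^sup>2" for x y :: real
  proof -
    have "2 * \<bar>x\<bar> * \<bar>y\<bar> \<le> \<bar>x\<bar>\<^sup>2 + \<bar>y\<bar>\<^sup>2" by (rule sum_squares_bound)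
    moreover have "0 \<le> \<bar>x\<bar> * \<bar>y\<bar>" by simp
    ultimately show ?thesis by (simp only: abs_mult power2_abs)
  qed
  then show "AE p in Q. norm (h p * g p) \<le> norm ((h p)\<^sup>2 + (g p)\<^sup>2)" by simp
qed

lemma square_int_add:
  assumes "square_int h" "square_int g"
  shows "square_int (\<lambda>p. h p + g p)"
  using assms square_int_mult[OF assms] by (auto simp: square_int_def power2_sum mult.assoc)

lemma square_int_cmult: "square_int h \<Longrightarrow> square_int (\<lambda>p. c * h p)"
  by (auto simp: square_int_def power_mult_distrib)

lemma square_int_diff: "square_int h \<Longrightarrow> square_int g \<Longrightarrow> square_int (\<lambda>p. h p - g p)"
  using square_int_add[of h "\<lambda>p. - 1 * g p"] square_int_cmult[of g "- 1"] by simp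

lemma square_int_sum: "(\<And>s. s \<in> A \<Longrightarrow> square_int (h s)) \<Longrightarrow> square_int (\<lambda>p. \<Sum>s\<in>A. h s p)"
  by (induction A rule: infinite_finite_induct) (auto simp: square_int_add, auto simp: square_int_def)

text \<open>Domination by the claim size places every function built from claims and indicators in
  L2 of the mark law.\<close>

lemma square_int_bounded:
  assumes "h \<in> borel_measurable mark_space" and "\<And>p. \<bar>h p\<bar> \<le> \<bar>snd p\<bar>"
  shows "square_int h"
  unfolding square_int_def
proof
  show "integrable Q (\<lambda>p. (h p)\<^sup>2)"
  proof (rule Bochner_Integration.integrable_bound[OF sq_int])
    show "(\<lambda>p. (h p)\<^sup>2) \<in> borel_measurable Q" using assms(1) by (intro measurable_Q) simp
    show "AE p in Q. norm ((h p)\<^sup>2) \<le> norm ((snd p)\<^sup>2)" using assms(2) by (simp add: abs_le_square_iff)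
  qed
qed fact

lemma square_int_le_part: "square_int (le_part t)"
  by (rule square_int_bounded) (auto simp: le_part_def)

lemma square_int_eq_part: "square_int (eq_part t)"
  by (rule square_int_bounded) (auto simp: eq_part_def)

definition e :: "nat \<Rightarrow> real" where "e t = (\<integral>p. le_part t p \<partial>Q)"

definition f :: "nat \<Rightarrow> real" where "f t = e (t + 1) / e t"

text \<open>The total growth rate of the years that enter the factor of index
  \<open>t\<close>.\<close>

definition Lam :: "nat \<Rightarrow> real" where "Lam t = (\<Sum>j = 1..T - t. lam j)"

text \<open>Written with \<open>le_part\<close> twice, so that summing over claims gives literally
  the numerator minus \<open>f t\<close> times the denominator of the estimated factor.\<close>

definition resid :: "nat \<Rightarrow> nat \<times> real \<Rightarrow> real" where
  "resid t p = le_part (t + 1) p - f t * le_part t p"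

text \<open>Collects, for accident year \<open>j\<close>, the coefficients of the residuals in the linearisation of
  the product of the estimated development factors; year \<open>j\<close> enters the factor of index \<open>s\<close> only
  if \<open>j \<le> T - s\<close>.\<close>

definition infl :: "nat \<Rightarrow> nat \<Rightarrow> nat \<times> real \<Rightarrow> real" where
  "infl t0 j p = (\<Sum>s = t0..T - j. (\<Prod>s = t0..T - 1. f s) / (Lam s * e s * f s) * resid s p)"

text \<open>Variance of the limiting normal law of the linear term. \<open>T - t0\<close> is the
  last year that enters any factor of index at least \<open>t0\<close>.\<close>

definition avar :: "nat \<Rightarrow> real" where
  "avar t0 = (\<Sum>j = 1..T - t0. lam j * (\<integral>p. (infl t0 j p)\<^sup>2 \<partial>Q))"

lemma e_Suc: "e (t + 1) = e t + (\<integral>p. eq_part (t + 1) p \<partial>Q)"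
  unfolding e_def le_part_Suc
  by (rule Bochner_Integration.integral_add) (auto intro: square_int_integrable square_int_le_part square_int_eq_part)

lemma e_0: "e 0 = 0"
proof -
  have "e 0 = (\<integral>p. 0 \<partial>Q)"
    unfolding e_def using dev_pos
    by (intro integral_cong_AE measurable_Q) (auto simp: le_part_def)
  then show ?thesis by simp
qed

text \<open>Claims may be negative, so positivity is obtained in the mean only: \<open>e\<close>
  starts at 0, as development begins at 1, and grows by the positive means of
  \<open>eq_part\<close>.\<close>

lemma e_pos: "t \<in> {1..T} \<Longrightarrow> 0 < e t"
proof (induction t)
  case (Suc t)
  then show ?case
    using e_Suc[of t] incr_pos[of "Suc t"] e_0 by (cases "t = 0") auto
qed simp

lemma dev_year: "t \<in> {1..T - 1} \<Longrightarrow> t \<in> {1..T}" "t \<in> {1..T - 1} \<Longrightarrow> t + 1 \<in> {1..T}"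
  using T by auto

lemma f_gt_1: "t \<in> {1..T - 1} \<Longrightarrow> 1 < f t"
  using e_pos[OF dev_year(1)] e_Suc[of t] incr_pos[OF dev_year(2)] by (simp add: f_def)

lemma Lam_pos: "t \<in> {1..T - 1} \<Longrightarrow> 0 < Lam t"
  unfolding Lam_def by (rule sum_pos) (use lam_pos T in auto)

lemma square_int_resid: "square_int (resid t)"
  unfolding resid_def[abs_def] by (intro square_int_diff square_int_cmult square_int_le_part)

lemma integral_resid: "t \<in> {1..T - 1} \<Longrightarrow> (\<integral>p. resid t p \<partial>Q) = 0"
  using e_pos[OF dev_year(1)[of t]]
  by (simp add: resid_def square_int_integrable square_int_le_part f_def flip: e_def)

lemma square_int_infl: "square_int (infl t0 j)"
  unfolding infl_def[abs_def] by (intro square_int_sum square_int_cmult square_int_resid)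

lemma integral_infl: "1 \<le> t0 \<Longrightarrow> 1 \<le> j \<Longrightarrow> (\<integral>p. infl t0 j p \<partial>Q) = 0"
  unfolding infl_def
proof (subst Bochner_Integration.integral_sum)
  fix s
  show "integrable Q (\<lambda>p. (\<Prod>s = t0..T - 1. f s) / (Lam s * e s * f s) * resid s p)"
    by (intro square_int_integrable square_int_cmult square_int_resid)
qed (auto intro!: sum.neutral simp: integral_resid)

text \<open>On the event that the development index is \<open>t + 1\<close> the residual equals the
  claim itself. Were it almost surely zero, \<open>eq_part (t + 1)\<close> would have mean
  zero.\<close>

lemma integral_resid_square_pos:
  assumes t: "t \<in> {1..T - 1}"
  shows "0 < (\<integral>p. (resid t p)\<^sup>2 \<partial>Q)"
proof (rule ccontr)
  assume "\<not> ?thesis"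
  moreover have "0 \<le> (\<integral>p. (resid t p)\<^sup>2 \<partial>Q)" by simp
  ultimately have "(\<integral>p. (resid t p)\<^sup>2 \<partial>Q) = 0" by linarith
  moreover have "integrable Q (\<lambda>p. (resid t p)\<^sup>2)" using square_int_resid by (simp add: square_int_def)
  ultimately have "AE p in Q. (resid t p)\<^sup>2 = 0"
    using integral_nonneg_eq_0_iff_AE[of Q "\<lambda>p. (resid t p)\<^sup>2"] by simp
  then have "AE p in Q. eq_part (t + 1) p = 0"
    by eventually_elim (auto simp: resid_def le_part_def eq_part_def split: if_splits)
  then have "(\<integral>p. eq_part (t + 1) p \<partial>Q) = (\<integral>p. 0 \<partial>Q)"
    by (intro integral_cong_AE measurable_Q) auto
  then show False using incr_pos[OF dev_year(2)[OF t]] by simp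
qed

text \<open>Year \<open>T - t0\<close> enters the factor of index \<open>t0\<close> and none of
  higher index. Its influence is a positive multiple of one residual, so nothing can cancel.\<close>

lemma avar_pos:
  assumes t0: "t0 \<in> {1..T - 1}"
  shows "0 < avar t0"
  unfolding avar_def
proof (rule sum_pos2[of _ "T - t0"])
  let ?c = "(\<Prod>s = t0..T - 1. f s) / (Lam t0 * e t0 * f t0)"
  have fpos: "0 < f s" if "s \<in> {1..T - 1}" for s using f_gt_1[OF that] by simp
  have "0 < ?c"
    using t0 by (intro divide_pos_pos prod_pos mult_pos_pos Lam_pos e_pos fpos) (use T in auto)
  moreover have "infl t0 (T - t0) p = ?c * resid t0 p" for p
    using t0 by (simp add: infl_def) (subst diff_diff_cancel, auto)
  ultimately have "(\<integral>p. (infl t0 (T - t0) p)\<^sup>2 \<partial>Q) = ?c\<^sup>2 * (\<integral>p. (resid t0 p)\<^sup>2 \<partial>Q)" and "0 < ?c\<^sup>2"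
    by (simp_all only: power_mult_distrib integral_mult_right_zero zero_less_power)
  then have "0 < (\<integral>p. (infl t0 (T - t0) p)\<^sup>2 \<partial>Q)"
    using integral_resid_square_pos[OF t0] by (metis mult_pos_pos)
  then show "0 < lam (T - t0) * (\<integral>p. (infl t0 (T - t0) p)\<^sup>2 \<partial>Q)"
    using lam_pos[of "T - t0"] t0 by (intro mult_pos_pos) auto
  show "0 \<le> lam j * (\<integral>p. (infl t0 j p)\<^sup>2 \<partial>Q)" if "j \<in> {1..T - t0}" for j
    using lam_pos[of j] that by (intro mult_nonneg_nonneg) (auto intro: less_imp_le)
qed (use t0 in auto)

lemma avar_orthogonal:
  assumes t0: "t0 \<in> {1..T - 1}"
    and orth: "\<And>s t. s \<in> {1..T - 1} \<Longrightarrow> t \<in> {1..T - 1} \<Longrightarrow> s \<noteq> t \<Longrightarrow> (\<integral>p. resid s p * resid t p \<partial>Q) = 0"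
  shows "avar t0 = (\<Prod>s = t0..T - 1. (f s)\<^sup>2) * (\<Sum>t = t0..T - 1. (\<integral>p. (resid t p)\<^sup>2 \<partial>Q) / (e t * (f t)\<^sup>2) / (Lam t * e t))"
proof -
  define b where "b s = (\<Prod>s = t0..T - 1. f s) / (Lam s * e s * f s)" for s
  have int: "integrable Q (\<lambda>p. resid s p * resid t p)" for s t
    by (rule square_int_mult[OF square_int_resid square_int_resid])
  have one: "(\<integral>p. (infl t0 j p)\<^sup>2 \<partial>Q) = (\<Sum>s = t0..T - j. (b s)\<^sup>2 * (\<integral>p. (resid s p)\<^sup>2 \<partial>Q))"
    if "1 \<le> j" for j
  proof -
    have "(infl t0 j p)\<^sup>2 = (\<Sum>s = t0..T - j. \<Sum>t = t0..T - j. b s * b t * (resid s p * resid t p))" for p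
      by (simp add: infl_def b_def power2_eq_square sum_product mult_ac)
    then have "(\<integral>p. (infl t0 j p)\<^sup>2 \<partial>Q) = (\<Sum>s = t0..T - j. \<Sum>t = t0..T - j. b s * b t * (\<integral>p. resid s p * resid t p \<partial>Q))"
      using int by (simp add: Bochner_Integration.integral_sum)
    also have "\<dots> = (\<Sum>s = t0..T - j. \<Sum>t = t0..T - j. if t = s then (b s)\<^sup>2 * (\<integral>p. (resid s p)\<^sup>2 \<partial>Q) else 0)"
    proof (intro sum.cong refl)
      fix s t assume "s \<in> {t0..T - j}" "t \<in> {t0..T - j}"
      then have "s \<in> {1..T - 1}" "t \<in> {1..T - 1}" using t0 that by auto
      then show "b s * b t * (\<integral>p. resid s p * resid t p \<partial>Q) = (if t = s then (b s)\<^sup>2 * (\<integral>p. (resid s p)\<^sup>2 \<partial>Q) else 0)"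
        using orth[of s t] by (simp add: power2_eq_square)
    qed
    also have "\<dots> = (\<Sum>s = t0..T - j. (b s)\<^sup>2 * (\<integral>p. (resid s p)\<^sup>2 \<partial>Q))"
      by (simp add: sum.delta)
    finally show ?thesis .
  qed
  have "avar t0 = (\<Sum>j = 1..T - t0. \<Sum>s = t0..T - j. lam j * ((b s)\<^sup>2 * (\<integral>p. (resid s p)\<^sup>2 \<partial>Q)))"
    unfolding avar_def by (intro sum.cong refl) (simp add: one sum_distrib_left)
  \<comment> \<open>The inner ranges describe the same triangle, as \<open>s \<le> T - j\<close> and
    \<open>j \<le> T - s\<close> agree there. Summing over \<open>j\<close> now collects the rates
    into \<open>Lam s\<close>, which cancels one of the two copies of \<open>Lam s\<close> in the
    squared coefficient.\<close>
  also have "\<dots> = (\<Sum>s = t0..T - 1. \<Sum>j = 1..T - s. lam j * ((b s)\<^sup>2 * (\<integral>p. (resid s p)\<^sup>2 \<partial>Q)))"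
    unfolding sum.Sigma[OF finite_atLeastAtMost ballI[OF finite_atLeastAtMost]]
    by (rule sum.reindex_bij_witness[of _ "\<lambda>(s, j). (j, s)" "\<lambda>(j, s). (s, j)"]) auto
  also have "\<dots> = (\<Sum>s = t0..T - 1. Lam s * ((b s)\<^sup>2 * (\<integral>p. (resid s p)\<^sup>2 \<partial>Q)))"
    by (simp add: Lam_def sum_distrib_right)
  also have "\<dots> = (\<Sum>s = t0..T - 1. (\<Prod>s = t0..T - 1. f s)\<^sup>2 * ((\<integral>p. (resid s p)\<^sup>2 \<partial>Q) / (e s * (f s)\<^sup>2) / (Lam s * e s)))"
  proof (intro sum.cong refl)
    fix s assume "s \<in> {t0..T - 1}"
    then have s: "s \<in> {1..T - 1}" using t0 by auto
    have "0 < Lam s" "0 < e s" "0 < f s" using Lam_pos[OF s] e_pos[of s] f_gt_1[OF s] s by auto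
    then show "Lam s * ((b s)\<^sup>2 * (\<integral>p. (resid s p)\<^sup>2 \<partial>Q))
        = (\<Prod>s = t0..T - 1. f s)\<^sup>2 * ((\<integral>p. (resid s p)\<^sup>2 \<partial>Q) / (e s * (f s)\<^sup>2) / (Lam s * e s))"
      unfolding b_def power_divide power_mult_distrib by (simp add: divide_simps power2_eq_square)
  qed
  finally show ?thesis by (simp add: sum_distrib_left prod_power_distrib)
qed

definition fh :: "nat \<Rightarrow> real \<Rightarrow> 'a \<Rightarrow> real" where
  "fh t \<alpha> \<omega> = (\<Sum>j = 1..T - t. CS (le_part (t + 1)) j \<alpha> \<omega>) / (\<Sum>j = 1..T - t. CS (le_part t) j \<alpha> \<omega>)"

lemma measurable_fh: "0 \<le> \<alpha> \<Longrightarrow> fh t \<alpha> \<in> borel_measurable M"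
  unfolding fh_def[abs_def] by (intro borel_measurable_divide borel_measurable_sum measurable_CS) auto

text \<open>The index \<open>t0\<close> is kept free of \<open>i\<close>; the theorem is the case
  \<open>t0 = T - i + 1\<close>.\<close>

definition stat :: "nat \<Rightarrow> nat \<Rightarrow> real \<Rightarrow> 'a \<Rightarrow> real" where
  "stat i t0 \<alpha> \<omega> = CS (le_part t0) i \<alpha> \<omega> * ((\<Prod>s = t0..T - 1. f s) - (\<Prod>s = t0..T - 1. fh s \<alpha> \<omega>))\<^sup>2"

lemma measurable_stat: "i \<in> {1..T} \<Longrightarrow> 0 \<le> \<alpha> \<Longrightarrow> stat i t0 \<alpha> \<in> borel_measurable M"
  unfolding stat_def[abs_def]
  by (intro borel_measurable_times borel_measurable_power borel_measurable_diff borel_measurable_prod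
      measurable_CS measurable_fh borel_measurable_const) auto

end

section \<open>The limit law along a sequence of parameters\<close>

locale chain_ladder_seq = chain_ladder_model M T Mc P Q lam + marked_model_seq M "{1..T}" Mc P mark_space Q lam a
  for M :: "'a measure" and T Mc P Q lam a
begin

lemma sqrt_a: "filterlim (\<lambda>n. sqrt (a n)) at_top sequentially" "0 < sqrt (a n)"
  using a_pos[of n] by (auto intro: filterlim_compose[OF sqrt_at_top a_lim])

definition V :: "nat \<Rightarrow> nat \<Rightarrow> 'a \<Rightarrow> real" where
  "V t n \<omega> = (\<Sum>j = 1..T - t. CS (resid t) j (a n) \<omega> / sqrt (a n))"

lemma tight_V: "t \<in> {1..T - 1} \<Longrightarrow> tight_seq (V t)"
  unfolding V_def[abs_def] using square_int_resid[of t] integral_resid[of t]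
  by (intro tight_seq_sum tight_CS) (auto simp: square_int_def)

lemma conv_prob_CS_le_part:
  "j \<in> {1..T} \<Longrightarrow> conv_prob (\<lambda>n \<omega>. CS (le_part t) j (a n) \<omega> / a n) (lam j * e t)"
  unfolding e_def using square_int_le_part[of t] by (intro weak_law_CS) (auto simp: square_int_def)

text \<open>Where the denominator \<open>Den\<close> is nonzero, the scaled error is exactly
  \<open>a n / Den\<close> times \<open>V t\<close>. The first factor converges to
  \<open>1 / (Lam t * e t)\<close> by the weak law and the second is tight.\<close>

lemma asymp_linear_fh:
  assumes t: "t \<in> {1..T - 1}"
  shows "asymp_linear (\<lambda>n. sqrt (a n)) (\<lambda>n. fh t (a n)) (f t) (\<lambda>n \<omega>. V t n \<omega> / (Lam t * e t))"
  unfolding asymp_linear_def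
proof
  define q where "q = Lam t * e t"
  have "q > 0" using Lam_pos[OF t] e_pos[of t] t by (auto simp: q_def)
  have a0: "0 \<le> a n" for n using a_pos[of n] by simp
  have J: "{1..T - t} \<subseteq> {1..T}" by auto
  show "tight_seq (\<lambda>n \<omega>. V t n \<omega> / (Lam t * e t))"
    using tight_seq_cmult[OF tight_V[OF t], of "1 / (Lam t * e t)"] by simp
  define Den where "Den n \<omega> = (\<Sum>j = 1..T - t. CS (le_part t) j (a n) \<omega>)" for n \<omega>
  have "conv_prob (\<lambda>n \<omega>. \<Sum>j = 1..T - t. CS (le_part t) j (a n) \<omega> / a n) (\<Sum>j = 1..T - t. lam j * e t)"
    using J by (intro conv_prob_sum conv_prob_CS_le_part) auto
  then have D: "conv_prob (\<lambda>n \<omega>. Den n \<omega> / a n) q"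
    by (simp add: Den_def q_def Lam_def sum_divide_distrib sum_distrib_right)
  have "conv_prob (\<lambda>n \<omega>. 1 / (Den n \<omega> / a n) - 1 / q) (1 / q - 1 / q)"
    using \<open>q > 0\<close> by (intro conv_prob_diff conv_prob_divide conv_prob_const D) auto
  then have "conv_prob (\<lambda>n \<omega>. (1 / (Den n \<omega> / a n) - 1 / q) * V t n \<omega>) 0"
    by (intro conv_prob_0_mult_tight tight_V[OF t]) simp
  \<comment> \<open>The two sequences differ only where \<open>Den\<close> vanishes and the quotient \<open>fh\<close> is junk.\<close>
  then show "conv_prob (\<lambda>n \<omega>. sqrt (a n) * (fh t (a n) \<omega> - f t) - V t n \<omega> / (Lam t * e t)) 0"
  proof (rule conv_prob_cong)
    note [measurable] = conv_prob_measurable[OF D] tight_seq_measurable[OF tight_V[OF t]] measurable_fh[OF a0]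
    show "(\<lambda>\<omega>. sqrt (a n) * (fh t (a n) \<omega> - f t) - V t n \<omega> / (Lam t * e t)) \<in> borel_measurable M" for n
      by measurable
    have eq: "(1 / (Den n \<omega> / a n) - 1 / q) * V t n \<omega> = sqrt (a n) * (fh t (a n) \<omega> - f t) - V t n \<omega> / (Lam t * e t)"
      if "Den n \<omega> \<noteq> 0" for n \<omega>
    proof -
      have V: "V t n \<omega> = (\<Sum>j = 1..T - t. CS (le_part (t + 1)) j (a n) \<omega>) / sqrt (a n) - f t * Den n \<omega> / sqrt (a n)"
        by (simp add: V_def Den_def resid_def[abs_def] CS_diff CS_cmult sum_subtractf diff_divide_distrib
            sum_divide_distrib sum_distrib_left)
      have "fh t (a n) \<omega> - f t = V t n \<omega> * sqrt (a n) / Den n \<omega>"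
        unfolding V fh_def Den_def[symmetric] using that a_pos[of n] by (simp add: field_simps)
      then have "sqrt (a n) * (fh t (a n) \<omega> - f t) = (sqrt (a n))\<^sup>2 / Den n \<omega> * V t n \<omega>"
        by (simp add: power2_eq_square)
      then show ?thesis using a0[of n] by (simp add: q_def left_diff_distrib)
    qed
    \<comment> \<open>If \<open>Den\<close> is zero, its normalised value misses the limit
      \<open>q\<close> by all of \<open>q\<close>, hence by more than \<open>q / 2\<close>; the bad
      event lies inside a deviation event.\<close>
    have lim: "(\<lambda>n. prob {\<omega> \<in> space M. q / 2 < \<bar>Den n \<omega> / a n - q\<bar>}) \<longlonglongrightarrow> 0"
      by (rule conv_probD[OF D]) (use \<open>q > 0\<close> in simp)
    have "prob {\<omega> \<in> space M. (1 / (Den n \<omega> / a n) - 1 / q) * V t n \<omega> \<noteq>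
        sqrt (a n) * (fh t (a n) \<omega> - f t) - V t n \<omega> / (Lam t * e t)} \<le>
        prob {\<omega> \<in> space M. q / 2 < \<bar>Den n \<omega> / a n - q\<bar>}" for n
    proof (rule finite_measure_mono)
      show "{\<omega> \<in> space M. (1 / (Den n \<omega> / a n) - 1 / q) * V t n \<omega> \<noteq>
          sqrt (a n) * (fh t (a n) \<omega> - f t) - V t n \<omega> / (Lam t * e t)} \<subseteq> {\<omega> \<in> space M. q / 2 < \<bar>Den n \<omega> / a n - q\<bar>}"
      proof safe
        fix \<omega> assume "(1 / (Den n \<omega> / a n) - 1 / q) * V t n \<omega> \<noteq>
          sqrt (a n) * (fh t (a n) \<omega> - f t) - V t n \<omega> / (Lam t * e t)"
        then have "Den n \<omega> = 0" using eq by blast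
        then show "q / 2 < \<bar>Den n \<omega> / a n - q\<bar>" using \<open>q > 0\<close> by simp
      qed
    qed measurable
    then show "(\<lambda>n. prob {\<omega> \<in> space M. (1 / (Den n \<omega> / a n) - 1 / q) * V t n \<omega> \<noteq>
        sqrt (a n) * (fh t (a n) \<omega> - f t) - V t n \<omega> / (Lam t * e t)}) \<longlonglongrightarrow> 0"
      by (intro tendsto_sandwich[OF _ _ tendsto_const lim]) auto
  qed
qed

text \<open>Exchanging the two sums replaces the dependent terms \<open>V s\<close> by one term per
  year, to which the central limit theorem for independent years applies.\<close>

lemma sum_V_eq_sum_infl:
  assumes "t0 \<in> {1..T - 1}"
  shows "(\<Prod>s = t0..T - 1. f s) * (\<Sum>s = t0..T - 1. V s n \<omega> / (Lam s * e s) / f s)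
    = (\<Sum>j = 1..T - t0. CS (infl t0 j) j (a n) \<omega> / sqrt (a n))"
proof -
  let ?b = "\<lambda>s. (\<Prod>s = t0..T - 1. f s) / (Lam s * e s * f s)"
  have "(\<Prod>s = t0..T - 1. f s) * (\<Sum>s = t0..T - 1. V s n \<omega> / (Lam s * e s) / f s)
      = (\<Sum>s = t0..T - 1. \<Sum>j = 1..T - s. ?b s * CS (resid s) j (a n) \<omega> / sqrt (a n))"
    by (simp add: V_def sum_distrib_left sum_divide_distrib mult_ac)
  also have "\<dots> = (\<Sum>j = 1..T - t0. \<Sum>s = t0..T - j. ?b s * CS (resid s) j (a n) \<omega> / sqrt (a n))"
    unfolding sum.Sigma[OF finite_atLeastAtMost ballI[OF finite_atLeastAtMost]]
    by (rule sum.reindex_bij_witness[of _ "\<lambda>(s, j). (j, s)" "\<lambda>(j, s). (s, j)"]) auto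
  also have "\<dots> = (\<Sum>j = 1..T - t0. CS (infl t0 j) j (a n) \<omega> / sqrt (a n))"
    unfolding infl_def[abs_def] CS_sum CS_cmult sum_divide_distrib ..
  finally show ?thesis .
qed

theorem weak_conv_stat:
  assumes i: "i \<in> {1..T}" and t0: "t0 \<in> {1..T - 1}"
  shows "weak_conv_m (\<lambda>n. distr M borel (stat i t0 (a n))) (distr chi_sq1 borel (\<lambda>y. lam i * e t0 * avar t0 * y))"
proof -
  define F where "F = (\<Prod>s = t0..T - 1. f s)"
  define A where "A = lam i * e t0"
  define s where "s = sqrt (avar t0)"
  define L where "L n \<omega> = (\<Sum>j = 1..T - t0. CS (infl t0 j) j (a n) \<omega> / sqrt (a n))" for n \<omega>
  define G where "G n \<omega> = sqrt (a n) * ((\<Prod>s = t0..T - 1. fh s (a n) \<omega>) - F)" for n \<omega>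
  have a0: "0 \<le> a n" for n using a_pos[of n] by simp
  have s: "s > 0" "s\<^sup>2 = avar t0" using avar_pos[OF t0] by (auto simp: s_def)
  have AL: "asymp_linear (\<lambda>n. sqrt (a n)) (\<lambda>n \<omega>. \<Prod>s = t0..T - 1. fh s (a n) \<omega>) F L"
  proof -
    have "asymp_linear (\<lambda>n. sqrt (a n)) (\<lambda>n \<omega>. \<Prod>s = t0..T - 1. fh s (a n) \<omega>) F
        (\<lambda>n \<omega>. F * (\<Sum>s = t0..T - 1. V s n \<omega> / (Lam s * e s) / f s))"
      unfolding F_def
    proof (rule asymp_linear_prod[OF _ _ _ sqrt_a])
      fix s assume "s \<in> {t0..T - 1}"
      then have s: "s \<in> {1..T - 1}" using t0 by auto
      show "asymp_linear (\<lambda>n. sqrt (a n)) (\<lambda>n. fh s (a n)) (f s) (\<lambda>n \<omega>. V s n \<omega> / (Lam s * e s))"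
        by (rule asymp_linear_fh[OF s])
      show "f s \<noteq> 0" using f_gt_1[OF s] by simp
    qed simp
    then show ?thesis unfolding F_def sum_V_eq_sum_infl[OF t0] L_def[abs_def] .
  qed
  have tG: "tight_seq G" using asymp_linear_tight[OF AL] by (simp add: G_def[abs_def])
  have tL: "tight_seq L" and GL: "conv_prob (\<lambda>n \<omega>. G n \<omega> - L n \<omega>) 0"
    using AL by (auto simp: asymp_linear_def G_def[abs_def])
  have C: "conv_prob (\<lambda>n \<omega>. CS (le_part t0) i (a n) \<omega> / a n - A) 0"
    using conv_prob_diff[OF conv_prob_CS_le_part[OF i, of t0] conv_prob_const[of A]] by (simp add: A_def)
  \<comment> \<open>The two errors made in passing from \<open>stat\<close>, which is
    \<open>C / a n * G^2\<close>, to \<open>A * L^2\<close>: replacing \<open>C / a n\<close> by its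
    limit \<open>A\<close>, and replacing \<open>G\<close> by \<open>L\<close> through the
    factorisation of \<open>G^2 - L^2\<close>. Each is a null factor times a tight one, up to the
    constant \<open>A\<close>.\<close>
  have "conv_prob (\<lambda>n \<omega>. (CS (le_part t0) i (a n) \<omega> / a n - A) * (G n \<omega> * G n \<omega>)
      + A * ((G n \<omega> - L n \<omega>) * (G n \<omega> + L n \<omega>))) (0 + A * 0)"
    by (intro conv_prob_add conv_prob_0_mult_tight conv_prob_mult conv_prob_const tight_seq_mult tight_seq_add C GL tG tL)
  moreover have "(CS (le_part t0) i (a n) \<omega> / a n - A) * (G n \<omega> * G n \<omega>)
      + A * ((G n \<omega> - L n \<omega>) * (G n \<omega> + L n \<omega>)) = stat i t0 (a n) \<omega> - (lam i * e t0 * avar t0) * (L n \<omega> / s)\<^sup>2" for n \<omega>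
  proof -
    have "stat i t0 (a n) \<omega> = CS (le_part t0) i (a n) \<omega> / a n * (G n \<omega>)\<^sup>2"
      using a_pos[of n] by (simp add: stat_def G_def power_mult_distrib power2_commute del: One_nat_def flip: F_def)
    moreover have "avar t0 * (L n \<omega> / s)\<^sup>2 = (L n \<omega>)\<^sup>2"
      unfolding s(2)[symmetric] using s(1) by (simp add: power_divide)
    then have "lam i * e t0 * avar t0 * (L n \<omega> / s)\<^sup>2 = A * (L n \<omega>)\<^sup>2"
      by (simp only: A_def mult.assoc)
    ultimately show ?thesis by (simp only:) (simp add: algebra_simps power2_eq_square)
  qed
  ultimately have diff: "conv_prob (\<lambda>n \<omega>. stat i t0 (a n) \<omega> - (lam i * e t0 * avar t0) * (L n \<omega> / s)\<^sup>2) 0"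
    by simp
  note [measurable] = tight_seq_measurable[OF tL]
  let ?g = "\<lambda>x. (lam i * e t0 * avar t0) * x\<^sup>2"
  have clt: "weak_conv_m (\<lambda>n. distr M borel (\<lambda>\<omega>. L n \<omega> / s)) std_normal_distribution"
    unfolding L_def using square_int_infl integral_infl t0 s
    by (intro clt_CS) (auto simp: square_int_def avar_def)
  have "weak_conv_m (\<lambda>n. distr (distr M borel (\<lambda>\<omega>. L n \<omega> / s)) borel ?g) (distr std_normal_distribution borel ?g)"
    by (rule weak_conv_m_continuous_map[OF _ real_dist_normal_dist clt])
       (auto intro!: real_distribution_distr continuous_intros)
  moreover have "distr (distr M borel (\<lambda>\<omega>. L n \<omega> / s)) borel ?g = distr M borel (\<lambda>\<omega>. ?g (L n \<omega> / s))" for n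
    by (subst distr_distr) (auto simp: comp_def)
  moreover have chi: "distr std_normal_distribution borel ?g = distr chi_sq1 borel (\<lambda>y. lam i * e t0 * avar t0 * y)"
    unfolding chi_sq1_def by (subst distr_distr) (auto simp: comp_def)
  ultimately have Lconv: "weak_conv_m (\<lambda>n. distr M borel (\<lambda>\<omega>. ?g (L n \<omega> / s)))
      (distr chi_sq1 borel (\<lambda>y. lam i * e t0 * avar t0 * y))"
    by simp
  show ?thesis
  proof (rule weak_conv_m_slutsky[OF _ _ _ Lconv diff])
    show "stat i t0 (a n) \<in> borel_measurable M" for n by (rule measurable_stat[OF i a0])
    interpret N: real_distribution std_normal_distribution by (rule real_dist_normal_dist)
    show "real_distribution (distr chi_sq1 borel (\<lambda>y. lam i * e t0 * avar t0 * y))"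
      unfolding chi[symmetric] by (rule N.real_distribution_distr) measurable
  qed measurable
qed

end

section \<open>From sequences to the real parameter, and orthogonality of the residuals\<close>

context chain_ladder_model
begin

lemma conv_distr_stat:
  assumes i: "i \<in> {1..T}" and t0: "t0 \<in> {1..T - 1}"
  shows "conv_distr_at_top M (stat i t0) (distr chi_sq1 borel (\<lambda>y. lam i * e t0 * avar t0 * y))"
  unfolding conv_distr_at_top_def
proof (intro conjI allI impI)
  show "\<forall>\<^sub>F \<alpha> in at_top. stat i t0 \<alpha> \<in> borel_measurable M"
    using eventually_ge_at_top[of 0] by eventually_elim (rule measurable_stat[OF i])
  fix x assume x: "isCont (cdf (distr chi_sq1 borel (\<lambda>y. lam i * e t0 * avar t0 * y))) x"
  show "((\<lambda>\<alpha>. cdf (distr M borel (stat i t0 \<alpha>)) x) \<longlongrightarrow> cdf (distr chi_sq1 borel (\<lambda>y. lam i * e t0 * avar t0 * y)) x) at_top"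
  proof (rule tendsto_at_topI_sequentially)
    fix X :: "nat \<Rightarrow> real" assume X: "filterlim X at_top sequentially"
    \<comment> \<open>Raising the sequence to at least 1 makes every term positive and changes only
      finitely many terms.\<close>
    define a where "a n = max 1 (X n)" for n
    have "filterlim a at_top sequentially"
      by (rule filterlim_at_top_mono[OF X]) (simp add: a_def)
    then interpret chain_ladder_seq M T Mc P Q lam a
      by unfold_locales (auto simp: a_def)
    have "(\<lambda>n. cdf (distr M borel (stat i t0 (a n))) x) \<longlonglongrightarrow> cdf (distr chi_sq1 borel (\<lambda>y. lam i * e t0 * avar t0 * y)) x"
      using weak_conv_stat[OF i t0] x by (simp add: weak_conv_m_def weak_conv_def)
    moreover have "\<forall>\<^sub>F n in sequentially. 1 \<le> X n"
      using X by (auto simp: filterlim_at_top)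
    then have "\<forall>\<^sub>F n in sequentially. cdf (distr M borel (stat i t0 (a n))) x = cdf (distr M borel (stat i t0 (X n))) x"
      by eventually_elim (simp add: a_def max_def)
    ultimately show "(\<lambda>n. cdf (distr M borel (stat i t0 (X n))) x) \<longlonglongrightarrow> cdf (distr chi_sq1 borel (\<lambda>y. lam i * e t0 * avar t0 * y)) x"
      by (rule Lim_transform_eventually)
  qed
qed

lemma integral_resid_square:
  "(\<integral>p. (resid t p)\<^sup>2 \<partial>Q) = (\<integral>p. (eq_part (t + 1) p)\<^sup>2 \<partial>Q) + (f t - 1)\<^sup>2 * (\<integral>p. (le_part t p)\<^sup>2 \<partial>Q)"
proof -
  have "(resid t p)\<^sup>2 = (eq_part (t + 1) p)\<^sup>2 + (f t - 1)\<^sup>2 * (le_part t p)\<^sup>2" for p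
    by (auto simp: resid_def le_part_def eq_part_def power2_eq_square algebra_simps)
  moreover have "integrable Q (\<lambda>p. (eq_part (t + 1) p)\<^sup>2)" "integrable Q (\<lambda>p. (f t - 1)\<^sup>2 * (le_part t p)\<^sup>2)"
    using square_int_eq_part square_int_le_part by (auto simp: square_int_def)
  ultimately show ?thesis by simp
qed

text \<open>The earlier residual lives on development indices up to \<open>s + 1 \<le> t\<close>,
  where the later one is \<open>1 - f t\<close> times the claim. If second moments are proportional
  to first moments, the integral reduces to \<open>e (s + 1) - f s * e s\<close>, which is zero by
  the definition of \<open>f\<close>.\<close>

lemma resid_orthogonal_aux:
  assumes c: "\<And>t. (\<integral>p. (le_part t p)\<^sup>2 \<partial>Q) = c * e t" and "s \<in> {1..T - 1}" "s < t"
  shows "(\<integral>p. resid s p * resid t p \<partial>Q) = 0"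
proof -
  have "resid s p * resid t p = (1 - f t) * ((le_part (s + 1) p)\<^sup>2 - f s * (le_part s p)\<^sup>2)" for p
    using \<open>s < t\<close> by (auto simp: resid_def le_part_def power2_eq_square algebra_simps)
  then have "(\<integral>p. resid s p * resid t p \<partial>Q) = (1 - f t) * ((\<integral>p. (le_part (s + 1) p)\<^sup>2 \<partial>Q) - f s * (\<integral>p. (le_part s p)\<^sup>2 \<partial>Q))"
    using square_int_le_part by (simp add: square_int_def)
  also have "\<dots> = (1 - f t) * (c * (e (s + 1) - f s * e s))"
    by (simp only: c) (simp add: algebra_simps)
  also have "e (s + 1) - f s * e s = 0"
    using e_pos[OF dev_year(1)[OF assms(2)]] by (simp add: f_def)
  finally show ?thesis by simp
qed

lemma resid_orthogonal:
  assumes "\<And>t. (\<integral>p. (le_part t p)\<^sup>2 \<partial>Q) = c * e t" and "s \<in> {1..T - 1}" "t \<in> {1..T - 1}" "s \<noteq> t"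
  shows "(\<integral>p. resid s p * resid t p \<partial>Q) = 0"
  using resid_orthogonal_aux[OF assms(1), of s t] resid_orthogonal_aux[OF assms(1), of t s] assms(2-)
  by (cases s t rule: linorder_cases) (auto simp: mult.commute)

end

section \<open>From the stated assumptions to the abstract model\<close>

lemma (in prob_space) indep_pair_vimage_algebra:
  assumes X: "X \<in> measurable M S" and Y: "Y \<in> measurable M R"
    and ind: "indep_set (sets (vimage_algebra (space M) X S)) (sets (vimage_algebra (space M) Y R))"
  shows "indep_pair S X R Y"
  unfolding indep_pair_def
proof (intro conjI ballI X Y)
  fix A B assume "A \<in> sets S" "B \<in> sets R"
  then have "X -` A \<inter> space M \<in> sets (vimage_algebra (space M) X S)" "Y -` B \<inter> space M \<in> sets (vimage_algebra (space M) Y R)"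
    by (auto intro: in_vimage_algebra)
  from indep_setD[OF ind this]
  show "prob (X -` A \<inter> Y -` B \<inter> space M) = prob (X -` A \<inter> space M) * prob (Y -` B \<inter> space M)"
    by (simp add: Int_ac)
qed

text \<open>Applied to the identity and to the square, this gives the first and second moments up to
  \<open>t\<close> the same factor, the probability of development by \<open>t\<close>.\<close>

lemma (in prob_space) indep_le_integral:
  fixes D :: "'a \<Rightarrow> nat" and Z :: "'a \<Rightarrow> real" and g :: "real \<Rightarrow> real"
  assumes ind: "indep_var borel (\<lambda>\<omega>. real (D \<omega>)) borel Z" and g [measurable]: "g \<in> borel_measurable borel"
    and int: "integrable M (\<lambda>\<omega>. g (Z \<omega>))"
  shows "(\<integral>\<omega>. g (Z \<omega>) * (if D \<omega> \<le> t then 1 else 0) \<partial>M) =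
    (\<integral>\<omega>. (if D \<omega> \<le> t then 1 else 0) \<partial>M) * (\<integral>\<omega>. g (Z \<omega>) \<partial>M)"
proof -
  let ?i = "\<lambda>x::real. if x \<le> real t then 1 else 0 :: real"
  have i: "?i \<in> borel_measurable borel" by measurable
  have "indep_var borel (?i \<circ> (\<lambda>\<omega>. real (D \<omega>))) borel (g \<circ> Z)"
    by (rule indep_var_compose[OF ind i g])
  then have iv: "indep_var borel (\<lambda>\<omega>. if D \<omega> \<le> t then 1 else 0 :: real) borel (\<lambda>\<omega>. g (Z \<omega>))"
    by (simp add: comp_def)
  have "integrable M (\<lambda>\<omega>. if D \<omega> \<le> t then 1 else 0 :: real)"
    by (rule integrable_const_bound[of _ 1]) (use indep_var_rv1[OF iv] in auto)
  from indep_var_lebesgue_integral[OF iv this int] show ?thesis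
    by (simp add: mult.commute)
qed

theorem theorem2:
  fixes M :: "'a measure" and T :: nat
    and Mc :: "nat \<Rightarrow> real \<Rightarrow> 'a \<Rightarrow> nat"
    and D :: "nat \<Rightarrow> nat \<Rightarrow> 'a \<Rightarrow> nat"
    and Z :: "nat \<Rightarrow> nat \<Rightarrow> 'a \<Rightarrow> real"
    and lam :: "nat \<Rightarrow> real"
    and i :: nat
  assumes P: "prob_space M"
    and T: "T \<ge> 2"
    and D_range: "\<And>j k \<omega>. j \<in> {1..T} \<Longrightarrow> k \<ge> 1 \<Longrightarrow> \<omega> \<in> space M \<Longrightarrow> D j k \<omega> \<in> {1..T}"
    and GM1_indep: "\<And>j. j \<in> {1..T} \<Longrightarrow>
       prob_space.indep_vars M (\<lambda>k. count_space UNIV \<Otimes>\<^sub>M borel) (\<lambda>k \<omega>. (D j k \<omega>, Z j k \<omega>)) {1::nat..}"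
    and GM1_ident: "\<And>j k. j \<in> {1..T} \<Longrightarrow> k \<ge> 1 \<Longrightarrow>
       distr M (count_space UNIV \<Otimes>\<^sub>M borel) (\<lambda>\<omega>. (D j k \<omega>, Z j k \<omega>)) =
       distr M (count_space UNIV \<Otimes>\<^sub>M borel) (\<lambda>\<omega>. (D 1 1 \<omega>, Z 1 1 \<omega>))"
    and GM1_sq: "integrable M (\<lambda>\<omega>. (Z 1 1 \<omega>)\<^sup>2)"
    and GM1_pos: "\<And>t. t \<in> {1..T} \<Longrightarrow> EZeq M (D 1 1) (Z 1 1) t > 0"
    and GM2: "\<And>j. j \<in> {1..T} \<Longrightarrow>
       (\<lambda>\<omega>. restrict (\<lambda>\<alpha>. Mc j \<alpha> \<omega>) {0::real..}) \<in> measurable M (PiM {0::real..} (\<lambda>_. count_space UNIV)) \<and>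
       (\<lambda>\<omega>. restrict (\<lambda>k. (D j k \<omega>, Z j k \<omega>)) {1::nat..}) \<in> measurable M (PiM {1::nat..} (\<lambda>_. count_space UNIV \<Otimes>\<^sub>M borel)) \<and>
       prob_space.indep_set M
         (sets (vimage_algebra (space M) (\<lambda>\<omega>. restrict (\<lambda>\<alpha>. Mc j \<alpha> \<omega>) {0::real..})
            (PiM {0::real..} (\<lambda>_. count_space UNIV))))
         (sets (vimage_algebra (space M) (\<lambda>\<omega>. restrict (\<lambda>k. (D j k \<omega>, Z j k \<omega>)) {1::nat..})
            (PiM {1::nat..} (\<lambda>_. count_space UNIV \<Otimes>\<^sub>M borel))))"
    and GM3: "prob_space.indep_vars M
       (\<lambda>j. PiM {0::real..} (\<lambda>_. count_space UNIV) \<Otimes>\<^sub>M PiM {1::nat..} (\<lambda>_. count_space UNIV \<Otimes>\<^sub>M borel))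
       (\<lambda>j \<omega>. (restrict (\<lambda>\<alpha>. Mc j \<alpha> \<omega>) {0::real..}, restrict (\<lambda>k. (D j k \<omega>, Z j k \<omega>)) {1::nat..}))
       {1..T}"
    and GM4_pos: "\<And>j. j \<in> {1..T} \<Longrightarrow> lam j > 0"
    and GM4: "\<And>j. j \<in> {1..T} \<Longrightarrow>
       AE \<omega> in M. ((\<lambda>\<alpha>. real (Mc j \<alpha> \<omega>) / \<alpha>) \<longlongrightarrow> lam j) at_top"
    and i: "i \<in> {2..T}"
  shows "\<exists>\<gamma>::real. \<gamma> > 0 \<and>
    conv_distr_at_top M
      (\<lambda>\<alpha> \<omega>. Cl Mc D Z \<alpha> i (T - i + 1) \<omega> *
          ((\<Prod>s = T - i + 1..T - 1. fdev M (D 1 1) (Z 1 1) s)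
           - (\<Prod>s = T - i + 1..T - 1. fhat T Mc D Z \<alpha> s \<omega>))\<^sup>2)
      (distr chi_sq1 borel (\<lambda>y. \<gamma>\<^sup>2 * y)) \<and>
    (prob_space.indep_var M borel (\<lambda>\<omega>. real (D 1 1 \<omega>)) borel (Z 1 1) \<longrightarrow>
      \<gamma>\<^sup>2 = lam i * EZle M (D 1 1) (Z 1 1) (T - i + 1)
        * (\<Prod>s = T - i + 1..T - 1. (fdev M (D 1 1) (Z 1 1) s)\<^sup>2)
        * (\<Sum>t = T - i + 1..T - 1.
             (sigma2 M (D 1 1) (Z 1 1) t / (fdev M (D 1 1) (Z 1 1) t)\<^sup>2)
             / (\<Sum>j = 1..T - t. lam j * EZle M (D 1 1) (Z 1 1) t)))"
proof -
  interpret prob_space M by (rule P)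
  define Q where "Q = distr M mark_space (\<lambda>\<omega>. (D 1 1 \<omega>, Z 1 1 \<omega>))"
  define Pm where "Pm j k \<omega> = (D j k \<omega>, Z j k \<omega>)" for j k \<omega>
  have one: "1 \<in> {1..T}" using T by simp
  have mark: "(\<lambda>\<omega>. (D 1 1 \<omega>, Z 1 1 \<omega>)) \<in> measurable M mark_space"
    using GM1_indep[OF one] by (auto simp: indep_vars_def)
  have expQ: "(\<integral>p. h p \<partial>Q) = (\<integral>\<omega>. h (D 1 1 \<omega>, Z 1 1 \<omega>) \<partial>M)"
    if "h \<in> borel_measurable mark_space" for h :: "nat \<times> real \<Rightarrow> real"
    unfolding Q_def by (rule integral_distr[OF mark that])
  interpret chain_ladder_model M T Mc Pm Q lam
  proof unfold_locales
    fix j :: nat assume j: "j \<in> {1..T}"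
    show "indep_vars (\<lambda>k. mark_space) (Pm j) {1..}"
      using GM1_indep[OF j] by (simp add: Pm_def[abs_def])
    show "distr M mark_space (Pm j k) = Q" if "1 \<le> k" for k
      unfolding Q_def Pm_def[abs_def] by (rule GM1_ident[OF j that])
    show "indep_pair (PiM {0..} (\<lambda>_. count_space UNIV)) (\<lambda>\<omega>. restrict (\<lambda>\<alpha>. Mc j \<alpha> \<omega>) {0..})
       (PiM {1..} (\<lambda>_. mark_space)) (\<lambda>\<omega>. restrict (\<lambda>k. Pm j k \<omega>) {1..})"
      using GM2[OF j] unfolding Pm_def by (blast intro: indep_pair_vimage_algebra)
    show "0 < lam j" by (rule GM4_pos[OF j])
    show "AE \<omega> in M. ((\<lambda>\<alpha>. real (Mc j \<alpha> \<omega>) / \<alpha>) \<longlongrightarrow> lam j) at_top" by (rule GM4[OF j])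
    show "0 < (\<integral>p. eq_part j p \<partial>Q)"
      using GM1_pos[OF j] by (simp add: expQ eq_part_def EZeq_def)
  next
    show "indep_vars (\<lambda>j. PiM {0..} (\<lambda>_. count_space UNIV) \<Otimes>\<^sub>M PiM {1..} (\<lambda>_. mark_space))
       (\<lambda>j \<omega>. (restrict (\<lambda>\<alpha>. Mc j \<alpha> \<omega>) {0..}, restrict (\<lambda>k. Pm j k \<omega>) {1..})) {1..T}"
      using GM3 by (simp add: Pm_def)
    show "2 \<le> T" by (rule T)
    show "integrable Q (\<lambda>p. (snd p)\<^sup>2)"
      unfolding Q_def using GM1_sq by (subst integrable_distr_eq[OF mark]) auto
    show "AE p in Q. 1 \<le> fst p"
      unfolding Q_def using D_range[OF one] by (subst AE_distr_iff[OF mark]) auto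
  qed
  define t0 where "t0 = T - i + 1"
  have t0: "t0 \<in> {1..T - 1}" and iT: "i \<in> {1..T}" using i T by (auto simp: t0_def)
  have e_eq: "EZle M (D 1 1) (Z 1 1) t = e t" for t
    by (simp add: EZle_def e_def expQ le_part_def)
  have f_eq: "fdev M (D 1 1) (Z 1 1) t = f t" for t
    by (simp only: fdev_def f_def e_eq)
  have Cl_eq: "Cl Mc D Z \<alpha> j t \<omega> = CS (le_part t) j \<alpha> \<omega>" for \<alpha> j t \<omega>
    by (simp add: Cl_def CS_def le_part_def Pm_def)
  have fh_eq: "fhat T Mc D Z \<alpha> t \<omega> = fh t \<alpha> \<omega>" for \<alpha> t \<omega>
    by (simp add: fhat_def fh_def Cl_eq)
  have stat_eq: "(\<lambda>\<alpha> \<omega>. Cl Mc D Z \<alpha> i t0 \<omega> * ((\<Prod>s = t0..T - 1. fdev M (D 1 1) (Z 1 1) s)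
      - (\<Prod>s = t0..T - 1. fhat T Mc D Z \<alpha> s \<omega>))\<^sup>2) = stat i t0"
    by (intro ext) (simp only: stat_def Cl_eq f_eq fh_eq)
  \<comment> \<open>One value has to serve both claims, so it is the root of the scale of the limit
    law; independence is used only to rewrite its square.\<close>
  define \<gamma> where "\<gamma> = sqrt (lam i * e t0 * avar t0)"
  have "0 < lam i * e t0 * avar t0"
    by (intro mult_pos_pos GM4_pos[OF iT] e_pos dev_year(1) avar_pos t0)
  then have \<gamma>: "0 < \<gamma>" "\<gamma>\<^sup>2 = lam i * e t0 * avar t0" by (auto simp: \<gamma>_def)
  have "\<gamma>\<^sup>2 = lam i * EZle M (D 1 1) (Z 1 1) t0 * (\<Prod>s = t0..T - 1. (fdev M (D 1 1) (Z 1 1) s)\<^sup>2)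
      * (\<Sum>t = t0..T - 1. (sigma2 M (D 1 1) (Z 1 1) t / (fdev M (D 1 1) (Z 1 1) t)\<^sup>2)
          / (\<Sum>j = 1..T - t. lam j * EZle M (D 1 1) (Z 1 1) t))"
    if ind: "indep_var borel (\<lambda>\<omega>. real (D 1 1 \<omega>)) borel (Z 1 1)"
  proof -
    have sq: "(\<integral>p. (le_part t p)\<^sup>2 \<partial>Q) = EZ2le M (D 1 1) (Z 1 1) t"
      "(\<integral>p. (eq_part t p)\<^sup>2 \<partial>Q) = EZ2eq M (D 1 1) (Z 1 1) t" for t
      by (auto simp: expQ le_part_def eq_part_def EZ2le_def EZ2eq_def power_mult_distrib
          intro!: Bochner_Integration.integral_cong)
    have Zint: "integrable M (Z 1 1)"
      using square_integrable_imp_integrable[OF indep_var_rv2[OF ind] GM1_sq] .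
    let ?p = "\<lambda>t. \<integral>\<omega>. (if D 1 1 \<omega> \<le> t then 1 else 0) \<partial>M :: real"
    have ep: "e t = ?p t * (\<integral>\<omega>. Z 1 1 \<omega> \<partial>M)" for t
      unfolding e_eq[symmetric] EZle_def using indep_le_integral[OF ind, of "\<lambda>z. z" t] Zint by simp
    have ep2: "(\<integral>p. (le_part t p)\<^sup>2 \<partial>Q) = ?p t * (\<integral>\<omega>. (Z 1 1 \<omega>)\<^sup>2 \<partial>M)" for t
      unfolding sq EZ2le_def using indep_le_integral[OF ind, of "\<lambda>z. z\<^sup>2" t] GM1_sq by simp
    \<comment> \<open>Since \<open>e 1\<close> is positive and has the mean of \<open>Z\<close> as a
      factor. Eliminating \<open>?p t\<close> then exhibits the constant of proportionality between
      second and first moments that orthogonality needs.\<close>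
    have "(\<integral>\<omega>. Z 1 1 \<omega> \<partial>M) \<noteq> 0"
      using e_pos[OF one] ep[of 1] by auto
    then have c: "(\<integral>p. (le_part t p)\<^sup>2 \<partial>Q) = (\<integral>\<omega>. (Z 1 1 \<omega>)\<^sup>2 \<partial>M) / (\<integral>\<omega>. Z 1 1 \<omega> \<partial>M) * e t" for t
      by (simp add: ep ep2)
    have sig: "(\<integral>p. (resid t p)\<^sup>2 \<partial>Q) / (e t * (f t)\<^sup>2) = sigma2 M (D 1 1) (Z 1 1) t / (f t)\<^sup>2"
      if t: "t \<in> {1..T - 1}" for t
    proof -
      have pos: "0 < e t" "0 < EZeq M (D 1 1) (Z 1 1) (t + 1)"
        using e_pos[OF dev_year(1)[OF t]] GM1_pos[OF dev_year(2)[OF t]] .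
      have "EZeq M (D 1 1) (Z 1 1) (t + 1) = (\<integral>p. eq_part (t + 1) p \<partial>Q)"
        by (simp add: expQ eq_part_def EZeq_def)
      \<comment> \<open>The mean of \<open>eq_part (t + 1)\<close> is the increment
        \<open>e (t + 1) - e t\<close>. In \<open>sigma2\<close> this denominator cancels against
        the outer \<open>f t - 1\<close> once \<open>sigma2\<close> is multiplied by
        \<open>e t\<close>, leaving the second moment of the residual.\<close>
      then have q: "EZeq M (D 1 1) (Z 1 1) (t + 1) = (f t - 1) * e t"
        using e_Suc[of t] pos by (simp add: f_def field_simps)
      have "sigma2 M (D 1 1) (Z 1 1) t * e t = (\<integral>p. (resid t p)\<^sup>2 \<partial>Q)"
        unfolding integral_resid_square sq sigma2_def f_eq e_eq q
        using pos unfolding q by (simp add: field_simps power2_eq_square)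
      then have "(\<integral>p. (resid t p)\<^sup>2 \<partial>Q) / e t = sigma2 M (D 1 1) (Z 1 1) t"
        using pos by (simp add: field_simps)
      then show ?thesis by (simp flip: divide_divide_eq_left)
    qed
    have "avar t0 = (\<Prod>s = t0..T - 1. (f s)\<^sup>2) *
        (\<Sum>t = t0..T - 1. (\<integral>p. (resid t p)\<^sup>2 \<partial>Q) / (e t * (f t)\<^sup>2) / (Lam t * e t))"
      by (rule avar_orthogonal[OF t0]) (rule resid_orthogonal[OF c])
    also have "\<dots> = (\<Prod>s = t0..T - 1. (f s)\<^sup>2) *
        (\<Sum>t = t0..T - 1. (sigma2 M (D 1 1) (Z 1 1) t / (f t)\<^sup>2) / (\<Sum>j = 1..T - t. lam j * e t))"
      using t0 by (intro arg_cong2[where f = "(*)"] sum.cong refl) (auto simp: sig Lam_def sum_distrib_right)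
    finally show ?thesis
      unfolding \<gamma>(2) e_eq f_eq by (simp only: mult.assoc)
  qed
  then show ?thesis
    using \<gamma>(1) conv_distr_stat[OF iT t0] unfolding t0_def[symmetric] stat_eq \<gamma>(2)[symmetric] by blast
qed

end
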